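(* Let $\beta=\frac{\mu}{n}$ for a constant $\mu>0$, and let $M=n^{O(1)}$. Then for some constant $c_8>0$ the simulated tempering Markov chain $\widehat P$ with the distributions $\rho_0,\dots,\rho_M$ for the 3-state mean-field ferromagnetic Potts model mixes in time $O(n^{c_8})$.
   Context: 3-state mean-field Potts model: $V=\{1,\dots,n\}$ (complete graph), configurations $x\in\Omega=\{1,2,3\}^V$, $\sigma_m(x)$ the number of vertices with spin $m$, $H(x)=\sum_{i<j}\delta_{x_i,x_j}$, $\pi_b(x)=e^{bH(x)}/Z(b)$. For $i=0,\dots,M$ let $\beta_i=i\beta/M$, $f_i(x)=\binom{n}{\sigma_1(x),\sigma_2(x),\sigma_3(x)}^{(i-M)/M}$ and $\rho_i(x)=\pi_{\beta_i}(x)f_i(x)/Z_i$ with $Z_i=\sum_x\pi_{\beta_i}(x)f_i(x)$. For a distribution $\rho$ on $\Omega$, the Metropolis chain $M_\rho$ proposes from $x$ the configuration $y$ obtained by setting a uniformly random vertex to a uniformly random spin, accepted with probability $\min(1,\rho(y)/\rho(x))$. The simulated tempering chain $\widehat P$: state space $\Omega\times\{0,\dots,M\}$; with probability $1/2$ a level move $(x,i)\to(x',i)$ with probability $\frac12M_{\rho_i}(x,x')$; otherwise a temperature move: choose $j=i\pm1$ with probability $1/2$ each (at the endpoints the single neighbor with probability $1/2$) and move to $(x,j)$ with probability $\min(1,\rho_j(x)/\rho_i(x))$. Its stationary distribution is $\rho_i(x)/(M+1)$. Mixing time is $\tau(\varepsilon)=\min\{t:\max_z\frac12\sum_w|\widehat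 P^{t'}(z,w)-\pi(w)|\le\varepsilon\ \forall t'\ge t\}$, here for fixed $\varepsilon\in(0,1)$. *)

theory Defs
  imports "HOL-Probability.Probability" "HOL-Library.Landau_Symbols"
begin

text \<open>Since n and the number of levels vary in the asymptotic statement, vertices and spins are
  natural numbers, and a configuration is an extensional function on the vertex set.\<close>

type_synonym config = "nat \<Rightarrow> nat"

definition vertices :: "nat \<Rightarrow> nat set" where
  "vertices n = {1..n}"

definition spins :: "nat set" where
  "spins = {1, 2, 3}"

definition configs :: "nat \<Rightarrow> config set" where
  "configs n = vertices n \<rightarrow>\<^sub>E spins"

definition spin_count :: "nat \<Rightarrow> nat \<Rightarrow> config \<Rightarrow> nat" where
  "spin_count n m x = card {v \<in> vertices n. x v = m}"

definition potts_H :: "nat \<Rightarrow> config \<Rightarrow> real" where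
  "potts_H n x = (\<Sum>(i, j) \<in> {(i, j). i \<in> vertices n \<and> j \<in> vertices n \<and> i < j}. of_bool (x i = x j))"

definition potts_Z :: "nat \<Rightarrow> real \<Rightarrow> real" where
  "potts_Z n b = (\<Sum>x\<in>configs n. exp (b * potts_H n x))"

definition gibbs :: "nat \<Rightarrow> real \<Rightarrow> config \<Rightarrow> real" where
  "gibbs n b x = exp (b * potts_H n x) / potts_Z n b"

definition multinomial3 :: "nat \<Rightarrow> config \<Rightarrow> real" where
  "multinomial3 n x =
     fact n / (fact (spin_count n 1 x) * fact (spin_count n 2 x) * fact (spin_count n 3 x))"

text \<open>In what follows, \<open>M\<close> is the top level, so that there are \<open>M + 1\<close> levels, and \<open>\<beta>\<close> is
  the inverse temperature at the top level.\<close>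

definition level_beta :: "real \<Rightarrow> nat \<Rightarrow> nat \<Rightarrow> real" where
  "level_beta \<beta> M i = real i * \<beta> / real M"

definition damping :: "nat \<Rightarrow> nat \<Rightarrow> nat \<Rightarrow> config \<Rightarrow> real" where
  "damping n M i x = multinomial3 n x powr ((real i - real M) / real M)"

definition level_Z :: "nat \<Rightarrow> real \<Rightarrow> nat \<Rightarrow> nat \<Rightarrow> real" where
  "level_Z n \<beta> M i = (\<Sum>x\<in>configs n. gibbs n (level_beta \<beta> M i) x * damping n M i x)"

definition level_dist :: "nat \<Rightarrow> real \<Rightarrow> nat \<Rightarrow> nat \<Rightarrow> config \<Rightarrow> real" where
  "level_dist n \<beta> M i x = gibbs n (level_beta \<beta> M i) x * damping n M i x / level_Z n \<beta> M i"

definition metropolis :: "nat \<Rightarrow> (config \<Rightarrow> real) \<Rightarrow> config \<Rightarrow> config pmf" where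
  "metropolis n \<rho> x = do {
     v \<leftarrow> pmf_of_set (vertices n);
     s \<leftarrow> pmf_of_set spins;
     accept \<leftarrow> bernoulli_pmf (min 1 (\<rho> (x(v := s)) / \<rho> x));
     return_pmf (if accept then x(v := s) else x)
   }"

text \<open>The level move is lazy: once it has been selected, a Metropolis step is made with
  probability 1/2, and the chain stays put otherwise.\<close>

definition level_move :: "nat \<Rightarrow> real \<Rightarrow> nat \<Rightarrow> config \<times> nat \<Rightarrow> (config \<times> nat) pmf" where
  "level_move n \<beta> M = (\<lambda>(x, i). do {
     active \<leftarrow> bernoulli_pmf (1/2);
     if active then do {
       x' \<leftarrow> metropolis n (level_dist n \<beta> M i) x;
       return_pmf (x', i)
     } else return_pmf (x, i)
   })"

definition temperature_move :: "nat \<Rightarrow> real \<Rightarrow> nat \<Rightarrow> config \<times> nat \<Rightarrow> (config \<times> nat) pmf" where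
  "temperature_move n \<beta> M = (\<lambda>(x, i). do {
     up \<leftarrow> bernoulli_pmf (1/2);
     let j = (if up then (if i < M then i + 1 else i) else (if 0 < i then i - 1 else i));
     accept \<leftarrow> bernoulli_pmf (min 1 (level_dist n \<beta> M j x / level_dist n \<beta> M i x));
     return_pmf (x, if accept then j else i)
   })"

definition tempering_chain :: "nat \<Rightarrow> real \<Rightarrow> nat \<Rightarrow> config \<times> nat \<Rightarrow> (config \<times> nat) pmf" where
  "tempering_chain n \<beta> M z = do {
     level \<leftarrow> bernoulli_pmf (1/2);
     if level then level_move n \<beta> M z else temperature_move n \<beta> M z
   }"

definition tempering_states :: "nat \<Rightarrow> nat \<Rightarrow> (config \<times> nat) set" where
  "tempering_states n M = configs n \<times> {0..M}"

definition tempering_stationary :: "nat \<Rightarrow> real \<Rightarrow> nat \<Rightarrow> config \<times> nat \<Rightarrow> real" where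
  "tempering_stationary n \<beta> M = (\<lambda>(x, i). level_dist n \<beta> M i x / (real M + 1))"

primrec chain_steps :: "('s \<Rightarrow> 's pmf) \<Rightarrow> nat \<Rightarrow> 's \<Rightarrow> 's pmf" where
  "chain_steps P 0 z = return_pmf z"
| "chain_steps P (Suc t) z = chain_steps P t z \<bind> P"

definition tv_to :: "'s set \<Rightarrow> ('s \<Rightarrow> 's pmf) \<Rightarrow> ('s \<Rightarrow> real) \<Rightarrow> nat \<Rightarrow> 's \<Rightarrow> real" where
  "tv_to S P \<pi> t z = 1/2 * (\<Sum>w\<in>S. \<bar>pmf (chain_steps P t z) w - \<pi> w\<bar>)"

text \<open>The value is \<open>\<infinity>\<close> if no such time exists.\<close>

definition mixing_time ::
  "'s set \<Rightarrow> ('s \<Rightarrow> 's pmf) \<Rightarrow> ('s \<Rightarrow> real) \<Rightarrow> real \<Rightarrow> enat" where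
  "mixing_time S P \<pi> \<epsilon> = (INF t \<in> {t. \<forall>t'\<ge>t. (MAX z\<in>S. tv_to S P \<pi> t' z) \<le> \<epsilon>}. enat t)"

definition tempering_mixing_time :: "nat \<Rightarrow> real \<Rightarrow> nat \<Rightarrow> real \<Rightarrow> enat" where
  "tempering_mixing_time n \<beta> M \<epsilon> =
     mixing_time (tempering_states n M) (tempering_chain n \<beta> M) (tempering_stationary n \<beta> M) \<epsilon>"

end

theory Submission
  imports Defs
begin

text \<open>Since the damping exponent and the inverse temperature are both linear in \<open>i\<close>, the weights
  of level \<open>i\<close> have the form \<open>a x * b x ^ i\<close> with \<open>a x\<close> the reciprocal of the multinomial
  coefficient. Hence the reciprocal of the probability of \<open>x\<close> is convex in \<open>i\<close>, and \<open>x\<close> can be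
  moved from any level down to level \<open>0\<close> through levels that give it, up to a factor polynomial
  in \<open>n\<close>, at least the mass that it has at the starting level. Neither the interaction nor the
  phase diagram of the Potts model matters.

  At level \<open>0\<close> all types \<open>(\<sigma>\<^sub>1, \<sigma>\<^sub>2, \<sigma>\<^sub>3)\<close> are equally likely, which is the law of a Polya urn. Drawing
  the spins one after the other gives a Poincare inequality for single spin flips by induction
  on \<open>n\<close>, with a constant that is linear in \<open>n\<close>. Together this bounds the relaxation time of the
  tempering chain by a polynomial, and the lazy level moves turn this into \<open>L\<^sup>2\<close> contraction.\<close>

section \<open>Reversible chains with a Poincare inequality\<close>

lemma weighted_sum_square_le:
  fixes p g :: "'a \<Rightarrow> real"
  assumes "\<And>x. x \<in> S \<Longrightarrow> p x \<ge> 0" "sum p S = 1"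
  shows "(\<Sum>x\<in>S. p x * g x)\<^sup>2 \<le> (\<Sum>x\<in>S. p x * (g x)\<^sup>2)"
proof -
  define m where "m = (\<Sum>x\<in>S. p x * g x)"
  have "0 \<le> (\<Sum>x\<in>S. p x * (g x - m)\<^sup>2)"
    using assms(1) by (intro sum_nonneg) auto
  also have "\<dots> = (\<Sum>x\<in>S. p x * (g x)\<^sup>2 - 2 * m * (p x * g x) + m\<^sup>2 * p x)"
    by (intro sum.cong) (auto simp: power2_eq_square algebra_simps)
  also have "\<dots> = (\<Sum>x\<in>S. p x * (g x)\<^sup>2) - 2 * m * m + m\<^sup>2 * 1"
    by (simp add: sum.distrib sum_subtractf sum_distrib_left[symmetric] m_def assms(2))
  finally show ?thesis by (simp add: m_def power2_eq_square)
qed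

text \<open>Expanding the squares turns both sides into the same quadratic in \<open>c\<close>. The
  cases of use are the second moment formula (\<open>c = 0\<close>), the minimality of the variance
  among deviations from a constant, and the splitting of a variance by conditioning.\<close>

lemma weighted_sum_square_decomp:
  fixes p g :: "'a \<Rightarrow> real"
  assumes "sum p S = 1"
  shows "(\<Sum>x\<in>S. p x * (g x - c)\<^sup>2) =
    (\<Sum>x\<in>S. p x * (g x - (\<Sum>y\<in>S. p y * g y))\<^sup>2) + ((\<Sum>y\<in>S. p y * g y) - c)\<^sup>2"
proof -
  define m where "m = (\<Sum>x\<in>S. p x * g x)"
  have *: "(\<Sum>x\<in>S. p x * (g x - d)\<^sup>2) = (\<Sum>x\<in>S. p x * (g x)\<^sup>2) - 2 * d * m + d\<^sup>2" for d
  proof -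
    have "(\<Sum>x\<in>S. p x * (g x - d)\<^sup>2)
      = (\<Sum>x\<in>S. p x * (g x)\<^sup>2 - 2 * d * (p x * g x) + d\<^sup>2 * p x)"
      by (intro sum.cong) (auto simp: power2_eq_square algebra_simps)
    also have "\<dots> = (\<Sum>x\<in>S. p x * (g x)\<^sup>2) - 2 * d * m + d\<^sup>2 * 1"
      by (simp add: sum.distrib sum_subtractf sum_distrib_left[symmetric] m_def assms)
    finally show ?thesis by simp
  qed
  show ?thesis
    unfolding m_def[symmetric] * by (simp add: power2_eq_square algebra_simps)
qed

lemma sum_square_le_card:
  fixes g :: "'a \<Rightarrow> real"
  shows "(\<Sum>x\<in>S. g x)\<^sup>2 \<le> real (card S) * (\<Sum>x\<in>S. (g x)\<^sup>2)"
  using Cauchy_Schwarz_ineq_sum[of "\<lambda>_. 1" g S] by simp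

text \<open>Centre \<open>f\<close> at \<open>f z\<close>, so that only the mass
  \<open>1 - p z\<close> contributes; Cauchy-Schwarz on it bounds the squared mean by
  \<open>1 - p z\<close> times the second moment. This is how a holding probability at
  \<open>z\<close> becomes a loss of variance in one step.\<close>

lemma variance_ge_atom:
  fixes p f :: "'a \<Rightarrow> real"
  assumes "finite S" "z \<in> S" "\<And>x. x \<in> S \<Longrightarrow> p x \<ge> 0" "sum p S = 1"
  shows "p z * (\<Sum>u\<in>S. p u * (f z - f u)\<^sup>2)
    \<le> (\<Sum>w\<in>S. p w * (f w)\<^sup>2) - (\<Sum>w\<in>S. p w * f w)\<^sup>2"
proof -
  define T where "T = S - {z}"
  define g where "g = (\<lambda>u. f u - f z)"
  have S: "S = insert z T" "z \<notin> T" "finite T" using assms T_def by auto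
  have pT: "sum p T = 1 - p z" using assms(4) S by simp
  have gz: "(\<Sum>u\<in>S. p u * h u) = (\<Sum>u\<in>T. p u * h u)" if "h z = 0" for h :: "'a \<Rightarrow> real"
    using S that by simp
  have var: "(\<Sum>w\<in>S. p w * (f w)\<^sup>2) - (\<Sum>w\<in>S. p w * f w)\<^sup>2
     = (\<Sum>w\<in>S. p w * (g w)\<^sup>2) - (\<Sum>w\<in>S. p w * g w)\<^sup>2"
  proof -
    have 1: "(\<Sum>w\<in>S. p w * g w) = (\<Sum>w\<in>S. p w * f w) - f z"
      using assms(4) by (simp add: g_def algebra_simps sum_subtractf sum_distrib_left[symmetric])
    show ?thesis
      using weighted_sum_square_decomp[OF assms(4), of f 0]
        weighted_sum_square_decomp[OF assms(4), of f "f z"]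
      unfolding 1 by (simp add: g_def)
  qed
  have cs: "(\<Sum>w\<in>T. p w * g w)\<^sup>2 \<le> (1 - p z) * (\<Sum>w\<in>T. p w * (g w)\<^sup>2)"
  proof -
    have "(\<Sum>w\<in>T. sqrt (p w) * (sqrt (p w) * g w))\<^sup>2
      \<le> (\<Sum>w\<in>T. (sqrt (p w))\<^sup>2) * (\<Sum>w\<in>T. (sqrt (p w) * g w)\<^sup>2)"
      by (rule Cauchy_Schwarz_ineq_sum)
    moreover have "(\<Sum>w\<in>T. (sqrt (p w))\<^sup>2) = sum p T"
      using assms(3) S by (intro sum.cong) auto
    moreover have "(\<Sum>w\<in>T. (sqrt (p w) * g w)\<^sup>2) = (\<Sum>w\<in>T. p w * (g w)\<^sup>2)"
      using assms(3) S by (intro sum.cong) (auto simp: power_mult_distrib)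
    moreover have "(\<Sum>w\<in>T. sqrt (p w) * (sqrt (p w) * g w)) = (\<Sum>w\<in>T. p w * g w)"
      using assms(3) S by (intro sum.cong) (auto simp: mult.assoc[symmetric])
    ultimately show ?thesis by (simp add: pT)
  qed
  have g0: "g z = 0" by (simp add: g_def)
  have "(\<Sum>u\<in>S. p u * (f z - f u)\<^sup>2) = (\<Sum>w\<in>T. p w * (g w)\<^sup>2)"
    by (subst gz) (auto simp: g_def power2_commute)
  then show ?thesis
    unfolding var using cs gz[of g, OF g0] gz[of "\<lambda>w. (g w)\<^sup>2"] g0
    by (simp add: algebra_simps)
qed

section \<open>L2 contraction of a reversible chain with positive holding probability\<close>

locale reversible_chain =
  fixes S :: "'s set" and P :: "'s \<Rightarrow> 's pmf" and \<pi> :: "'s \<Rightarrow> real"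
  assumes finite_states: "finite S"
    and closed: "z \<in> S \<Longrightarrow> set_pmf (P z) \<subseteq> S"
    and stationary_pos: "z \<in> S \<Longrightarrow> \<pi> z > 0"
    and stationary_sum: "sum \<pi> S = 1"
    and balance: "z \<in> S \<Longrightarrow> w \<in> S \<Longrightarrow> \<pi> z * pmf (P z) w = \<pi> w * pmf (P w) z"
begin

definition mean :: "('s \<Rightarrow> real) \<Rightarrow> real" where
  "mean f = (\<Sum>z\<in>S. \<pi> z * f z)"

definition variance :: "('s \<Rightarrow> real) \<Rightarrow> real" where
  "variance f = (\<Sum>z\<in>S. \<pi> z * (f z - mean f)\<^sup>2)"

definition apply_kernel :: "('s \<Rightarrow> real) \<Rightarrow> 's \<Rightarrow> real" where
  "apply_kernel f z = (\<Sum>w\<in>S. pmf (P z) w * f w)"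

text \<open>Each ordered pair counts, without the customary factor 1/2, so this is twice the usual
  Dirichlet form.\<close>

definition dirichlet :: "('s \<Rightarrow> real) \<Rightarrow> real" where
  "dirichlet f = (\<Sum>z\<in>S. \<pi> z * (\<Sum>w\<in>S. pmf (P z) w * (f z - f w)\<^sup>2))"

lemma row_sum: "z \<in> S \<Longrightarrow> (\<Sum>w\<in>S. pmf (P z) w) = 1"
  using closed finite_states by (simp add: sum_pmf_eq_1)

lemma mean_apply_kernel: "mean (apply_kernel f) = mean f"
proof -
  have "mean (apply_kernel f) = (\<Sum>z\<in>S. \<Sum>w\<in>S. \<pi> z * pmf (P z) w * f w)"
    by (simp add: mean_def apply_kernel_def sum_distrib_left mult.assoc)
  also have "\<dots> = (\<Sum>w\<in>S. \<Sum>z\<in>S. \<pi> w * pmf (P w) z * f w)"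
    by (subst sum.swap) (intro sum.cong refl, simp add: balance)
  also have "\<dots> = (\<Sum>w\<in>S. \<pi> w * f w * (\<Sum>z\<in>S. pmf (P w) z))"
    by (simp add: sum_distrib_left mult_ac)
  also have "\<dots> = mean f" by (simp add: mean_def row_sum)
  finally show ?thesis .
qed

lemma variance_eq: "variance f = mean (\<lambda>z. (f z)\<^sup>2) - (mean f)\<^sup>2"
  using weighted_sum_square_decomp[OF stationary_sum, of f 0]
  by (simp add: variance_def mean_def)

lemma variance_le: "variance f \<le> mean (\<lambda>z. (f z - c)\<^sup>2)"
  using weighted_sum_square_decomp[OF stationary_sum, of f c]
  by (simp add: variance_def mean_def)

text \<open>Since the kernel preserves means, the drop in variance is the stationary average of the
  variances of \<open>f\<close> under the laws \<open>P z\<close>. Each of them is bounded below by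
  \<open>variance_ge_atom\<close> at the atom \<open>z\<close> itself.\<close>

lemma variance_apply_kernel:
  assumes hold: "\<And>z. z \<in> S \<Longrightarrow> pmf (P z) z \<ge> a"
  shows "variance (apply_kernel f) \<le> variance f - a * dirichlet f"
proof -
  have "a * dirichlet f \<le> (\<Sum>z\<in>S. \<pi> z * (pmf (P z) z * (\<Sum>w\<in>S. pmf (P z) w * (f z - f w)\<^sup>2)))"
    unfolding dirichlet_def
  proof (subst sum_distrib_left, intro sum_mono)
    fix z assume z: "z \<in> S"
    have "a * (\<Sum>w\<in>S. pmf (P z) w * (f z - f w)\<^sup>2)
       \<le> pmf (P z) z * (\<Sum>w\<in>S. pmf (P z) w * (f z - f w)\<^sup>2)"
      using hold[OF z] by (intro mult_right_mono sum_nonneg) auto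
    from mult_left_mono[OF this, of "\<pi> z"] stationary_pos[OF z]
    show "a * (\<pi> z * (\<Sum>w\<in>S. pmf (P z) w * (f z - f w)\<^sup>2))
      \<le> \<pi> z * (pmf (P z) z * (\<Sum>w\<in>S. pmf (P z) w * (f z - f w)\<^sup>2))"
      by (simp add: mult_ac)
  qed
  also have "\<dots> \<le> (\<Sum>z\<in>S. \<pi> z * (apply_kernel (\<lambda>w. (f w)\<^sup>2) z - (apply_kernel f z)\<^sup>2))"
    unfolding apply_kernel_def
    by (intro sum_mono mult_left_mono variance_ge_atom less_imp_le[OF stationary_pos])
       (auto simp: finite_states row_sum)
  also have "\<dots> = mean (apply_kernel (\<lambda>w. (f w)\<^sup>2)) - mean (\<lambda>z. (apply_kernel f z)\<^sup>2)"
    by (simp add: mean_def sum_subtractf algebra_simps)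
  also have "\<dots> = variance f - variance (apply_kernel f)"
    by (simp add: variance_eq mean_apply_kernel)
  finally show ?thesis by simp
qed

lemma closed_steps: "z \<in> S \<Longrightarrow> set_pmf (chain_steps P t z) \<subseteq> S"
  by (induction t) (use closed in \<open>auto simp: set_bind_pmf\<close>)

definition density :: "'s \<Rightarrow> nat \<Rightarrow> 's \<Rightarrow> real" where
  "density z t w = pmf (chain_steps P t z) w / \<pi> w"

text \<open>Detailed balance moves the stationary weights across the kernel, so densities evolve
  under the kernel of the chain rather than under an adjoint.\<close>

lemma density_Suc:
  assumes "z \<in> S" "w \<in> S"
  shows "density z (Suc t) w = apply_kernel (density z t) w"
proof -
  have "pmf (chain_steps P (Suc t) z) w = (\<Sum>u\<in>S. pmf (P u) w * pmf (chain_steps P t z) u)"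
    using closed_steps[OF assms(1), of t] finite_states
    by (simp add: pmf_bind integral_measure_pmf_real[where A = S] subset_iff)
  also have "\<dots> = (\<Sum>u\<in>S. \<pi> w * pmf (P w) u * density z t u)"
  proof (intro sum.cong refl)
    fix u assume u: "u \<in> S"
    show "pmf (P u) w * pmf (chain_steps P t z) u = \<pi> w * pmf (P w) u * density z t u"
      using balance[OF u assms(2)] stationary_pos[OF u]
      by (simp add: density_def field_simps)
  qed
  also have "\<dots> = \<pi> w * apply_kernel (density z t) w"
    by (simp add: apply_kernel_def sum_distrib_left mult.assoc)
  finally show ?thesis
    using stationary_pos[OF assms(2)] by (simp add: density_def)
qed

lemma mean_density: "z \<in> S \<Longrightarrow> mean (density z t) = 1"
proof -
  assume z: "z \<in> S"
  have "mean (density z t) = (\<Sum>w\<in>S. pmf (chain_steps P t z) w)"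
    unfolding mean_def density_def using stationary_pos
    by (intro sum.cong) (auto simp: less_imp_neq[symmetric])
  then show ?thesis using closed_steps[OF z] finite_states by (simp add: sum_pmf_eq_1)
qed

lemma variance_cong: "(\<And>z. z \<in> S \<Longrightarrow> f z = g z) \<Longrightarrow> variance f = variance g"
  by (simp add: variance_def mean_def)

text \<open>At time \<open>0\<close> the second moment of the density is \<open>1 / \<pi> z\<close>;
  every step then removes a fraction \<open>a / L\<close> of the variance by the Poincare
  inequality.\<close>

lemma variance_density:
  assumes hold: "\<And>z. z \<in> S \<Longrightarrow> pmf (P z) z \<ge> a" and a: "a \<ge> 0" and "L > 0" "a \<le> L"
    and poincare: "\<And>f. variance f \<le> L * dirichlet f" and z: "z \<in> S"
  shows "variance (density z t) \<le> (1 - a / L) ^ t / \<pi> z"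
proof (induction t)
  case 0
  have "variance (density z 0) \<le> mean (\<lambda>w. (density z 0 w)\<^sup>2)"
    by (simp add: variance_eq)
  also have "\<dots> = (\<Sum>w\<in>S. if w = z then 1 / \<pi> z else 0)"
    unfolding mean_def density_def using stationary_pos
    by (intro sum.cong) (auto simp: power2_eq_square less_imp_neq[symmetric])
  also have "\<dots> = 1 / \<pi> z" using z finite_states by simp
  finally show ?case by simp
next
  case (Suc t)
  have "variance (density z (Suc t)) = variance (apply_kernel (density z t))"
    by (intro variance_cong density_Suc z)
  also have "\<dots> \<le> variance (density z t) - a * dirichlet (density z t)"
    by (rule variance_apply_kernel[OF hold])
  also have "\<dots> \<le> (1 - a / L) * variance (density z t)"
    using mult_left_mono[OF poincare[of "density z t"], of "a / L"] a \<open>L > 0\<close>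
    by (simp add: algebra_simps)
  also have "\<dots> \<le> (1 - a / L) * ((1 - a / L) ^ t / \<pi> z)"
    using \<open>L > 0\<close> \<open>a \<le> L\<close> by (intro mult_left_mono Suc.IH) simp
  finally show ?case by simp
qed

text \<open>The L1 norm of the density minus its mean \<open>1\<close> is at most the L2
  norm.\<close>

lemma tv_to_le:
  assumes "z \<in> S"
  shows "tv_to S P \<pi> t z \<le> sqrt (variance (density z t)) / 2"
proof -
  have "(\<Sum>w\<in>S. \<bar>pmf (chain_steps P t z) w - \<pi> w\<bar>) = (\<Sum>w\<in>S. \<pi> w * \<bar>density z t w - 1\<bar>)"
  proof (intro sum.cong refl)
    fix w assume "w \<in> S"
    then have "\<pi> w > 0" by (rule stationary_pos)
    then show "\<bar>pmf (chain_steps P t z) w - \<pi> w\<bar> = \<pi> w * \<bar>density z t w - 1\<bar>"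
      by (simp add: density_def field_simps)
  qed
  moreover have "(\<Sum>w\<in>S. \<pi> w * \<bar>density z t w - 1\<bar>)\<^sup>2 \<le> variance (density z t)"
    using weighted_sum_square_le[of S \<pi> "\<lambda>w. \<bar>density z t w - 1\<bar>"] stationary_pos
    by (simp add: variance_def mean_density assms stationary_sum less_imp_le)
  ultimately show ?thesis
    by (simp add: tv_to_def real_le_rsqrt)
qed

end

section \<open>The Polya urn measure\<close>

lemma finite_vertices [simp]: "finite (vertices n)" by (simp add: vertices_def)
lemma finite_spins [simp]: "finite spins" by (simp add: spins_def)
lemma finite_configs [simp]: "finite (configs n)"
  unfolding configs_def by (intro finite_PiE) auto
lemma card_vertices [simp]: "card (vertices n) = n" by (simp add: vertices_def)
lemma card_spins [simp]: "card spins = 3" by (simp add: spins_def)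

lemma sum_spins: "(\<Sum>s\<in>spins. f s) = f 1 + (f 2 + f 3)" for f :: "nat \<Rightarrow> 'a::comm_monoid_add"
  by (simp add: spins_def)

lemma card_configs: "card (configs n) = 3 ^ n"
  by (simp add: configs_def card_PiE)

lemma configs_spin: "x \<in> configs n \<Longrightarrow> v \<in> vertices n \<Longrightarrow> x v \<in> spins"
  by (auto simp: configs_def)

lemma configs_upd: "x \<in> configs n \<Longrightarrow> v \<in> vertices n \<Longrightarrow> s \<in> spins \<Longrightarrow> x(v := s) \<in> configs n"
  by (auto simp: configs_def PiE_def extensional_def)

lemma vertices_Suc: "vertices (Suc n) = insert (Suc n) (vertices n)"
  by (auto simp: vertices_def)

lemma configs_nonempty: "configs n \<noteq> {}"
  using card_configs[of n] by auto

lemma sum_configs_Suc: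
  "(\<Sum>x\<in>configs (Suc n). F x) = (\<Sum>x\<in>configs n. \<Sum>s\<in>spins. F (x(Suc n := s)))"
proof -
  have new: "Suc n \<notin> vertices n" by (simp add: vertices_def)
  have "(\<Sum>x\<in>configs (Suc n). F x) = sum F ((\<lambda>(s, x). x(Suc n := s)) ` (spins \<times> configs n))"
    by (simp add: configs_def vertices_Suc PiE_insert_eq)
  also have "\<dots> = (\<Sum>(s, x)\<in>spins \<times> configs n. F (x(Suc n := s)))"
    using inj_combinator[OF new, of "\<lambda>_. spins"]
    by (subst sum.reindex) (auto simp: configs_def case_prod_unfold)
  also have "\<dots> = (\<Sum>x\<in>configs n. \<Sum>s\<in>spins. F (x(Suc n := s)))"
    by (subst sum.cartesian_product[symmetric], rule sum.swap)
  finally show ?thesis .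
qed

text \<open>The map \<open>(x, s) \<mapsto> (x(v := s), x v)\<close> is an involution: it exchanges
  the spin at \<open>v\<close> with the proposed one.\<close>

lemma sum_configs_flip:
  assumes v: "v \<in> vertices n"
  shows "(\<Sum>x\<in>configs n. \<Sum>s\<in>spins. G x s) = (\<Sum>x\<in>configs n. \<Sum>s\<in>spins. G (x(v := s)) (x v))"
  unfolding sum.cartesian_product
  by (rule sum.reindex_bij_witness[where i = "\<lambda>(x, s). (x(v := s), x v)"
        and j = "\<lambda>(x, s). (x(v := s), x v)"])
     (auto simp: v configs_upd configs_spin)

lemma spin_count_Suc:
  "spin_count (Suc n) m (x(Suc n := s)) = spin_count n m x + of_bool (m = s)"
proof -
  have "{v \<in> vertices (Suc n). (x(Suc n := s)) v = m}
      = {v \<in> vertices n. x v = m} \<union> (if m = s then {Suc n} else {})"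
    by (auto simp: vertices_def)
  then show ?thesis
    by (auto simp: spin_count_def vertices_def card_insert_if)
qed

lemma spin_count_upd:
  assumes "v \<in> vertices n" "x v \<noteq> s"
  shows "spin_count n m (x(v := s)) + of_bool (m = x v) = spin_count n m x + of_bool (m = s)"
proof -
  have fin: "finite {u \<in> vertices n. u \<noteq> v \<and> x u = m}" by simp
  have "{u \<in> vertices n. (x(v := s)) u = m}
      = {u \<in> vertices n. u \<noteq> v \<and> x u = m} \<union> (if m = s then {v} else {})"
    "{u \<in> vertices n. x u = m}
      = {u \<in> vertices n. u \<noteq> v \<and> x u = m} \<union> (if m = x v then {v} else {})"
    using assms by auto
  then show ?thesis
    using fin assms(2) by (auto simp: spin_count_def)
qed

lemma spin_count_pos: "v \<in> vertices n \<Longrightarrow> spin_count n (x v) x > 0"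
  by (auto simp: spin_count_def card_gt_0_iff)

lemma spin_count_le: "spin_count n m x \<le> n"
  unfolding spin_count_def by (rule order_trans[OF card_mono[of "vertices n"]]) auto

lemma sum_spin_count:
  assumes "x \<in> configs n"
  shows "(\<Sum>s\<in>spins. spin_count n s x) = n"
proof -
  have "(\<Sum>s\<in>spins. spin_count n s x) = card (vertices n)"
  proof -
    have "vertices n = (\<Union>s\<in>spins. {v \<in> vertices n. x v = s})"
      using configs_spin[OF assms] by auto
    then have "card (vertices n) = card (\<Union>s\<in>spins. {v \<in> vertices n. x v = s})" by (rule arg_cong)
    also have "\<dots> = (\<Sum>s\<in>spins. spin_count n s x)"
      unfolding spin_count_def by (rule card_UN_disjoint) auto
    finally show ?thesis ..
  qed
  then show ?thesis by simp
qed

text \<open>The vertices of spin \<open>s\<close> contribute \<open>G s\<close> in total if there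
  are any and nothing otherwise, which is why equality can fail. It removes the class sizes that
  arise when flips are reversed in \<open>polya_poincare\<close>.\<close>

lemma sum_vertices_by_spin:
  fixes G :: "nat \<Rightarrow> real"
  assumes "x \<in> configs n" "\<And>s. G s \<ge> 0"
  shows "(\<Sum>v\<in>vertices n. G (x v) / spin_count n (x v) x) \<le> (\<Sum>s\<in>spins. G s)"
proof -
  have "(\<Sum>v\<in>vertices n. G (x v) / spin_count n (x v) x)
     = (\<Sum>s\<in>spins. \<Sum>v\<in>{v\<in>vertices n. x v = s}. G (x v) / spin_count n (x v) x)"
    using configs_spin[OF assms(1)] by (intro sum.group[symmetric]) auto
  also have "\<dots> = (\<Sum>s\<in>spins. spin_count n s x * (G s / spin_count n s x))"
    by (intro sum.cong refl) (simp add: spin_count_def)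
  also have "\<dots> \<le> (\<Sum>s\<in>spins. G s)"
    using assms(2) by (intro sum_mono) auto
  finally show ?thesis .
qed

text \<open>The mixture, over a uniformly distributed parameter of the simplex, of the product measures
  on configurations.\<close>

definition polya :: "nat \<Rightarrow> config \<Rightarrow> real" where
  "polya n x = 2 * (fact (spin_count n 1 x) * fact (spin_count n 2 x) * fact (spin_count n 3 x))
     / fact (n + 2)"

section \<open>Urn steps and the Poincare inequality of the urn measure\<close>

lemma polya_pos: "polya n x > 0"
  by (simp add: polya_def)

text \<open>The urn rule when the urn starts with one ball of each colour: the conditional
  probability that the next vertex receives \<open>s\<close>.\<close>

definition polya_next :: "nat \<Rightarrow> config \<Rightarrow> nat \<Rightarrow> real" where
  "polya_next n x s = (real (spin_count n s x) + 1) / (real n + 3)"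

lemma polya_next_pos: "polya_next n x s > 0"
  by (simp add: polya_next_def add_nonneg_pos)

lemma sum_polya_next: "x \<in> configs n \<Longrightarrow> (\<Sum>s\<in>spins. polya_next n x s) = 1"
  using sum_spin_count[of x n]
  by (simp add: polya_next_def sum_spins add_divide_distrib[symmetric] flip: of_nat_add)

lemma polya_Suc:
  assumes "s \<in> spins"
  shows "polya (Suc n) (x(Suc n := s)) = polya n x * polya_next n x s"
proof -
  have f: "fact (Suc n + 2) = (real n + 3) * fact (n + 2)" by (simp add: algebra_simps)
  show ?thesis
    using assms unfolding spins_def polya_def polya_next_def spin_count_Suc f
    by (auto simp: field_simps simp del: fact_Suc) (auto simp: algebra_simps)
qed

lemma sum_polya: "(\<Sum>x\<in>configs n. polya n x) = 1"
proof (induction n)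
  case 0
  have "configs 0 = {\<lambda>_. undefined}" by (simp add: configs_def vertices_def)
  then show ?case by (simp add: polya_def spin_count_def vertices_def)
next
  case (Suc n)
  have "(\<Sum>x\<in>configs (Suc n). polya (Suc n) x)
      = (\<Sum>x\<in>configs n. polya n x * (\<Sum>s\<in>spins. polya_next n x s))"
    by (simp add: sum_configs_Suc polya_Suc sum_distrib_left)
  then show ?case by (simp add: sum_polya_next Suc)
qed

text \<open>Only two factorials change under a flip: one loses its top factor, the other gains
  one.\<close>

lemma polya_upd:
  assumes "v \<in> vertices n" "x v \<in> spins" "s \<in> spins" "s \<noteq> x v"
  shows "polya n (x(v := s)) * spin_count n (x v) x = polya n x * (real (spin_count n s x) + 1)"
proof -
  obtain k where k: "spin_count n (x v) x = Suc k"
    using spin_count_pos[OF assms(1), of x] gr0_implies_Suc by blast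
  have upd: "spin_count n m (x(v := s)) =
      (if m = s then Suc (spin_count n s x) else if m = x v then k else spin_count n m x)" for m
    using spin_count_upd[OF assms(1), of x s m] assms(4) k by (auto split: if_splits)
  show ?thesis
    using assms(2-4) k unfolding polya_def upd spins_def
    by (auto simp: algebra_simps)
qed

text \<open>Induction with the spin of the last vertex integrated out first. The variance given the
  first \<open>n\<close> spins is paid by flips of the new vertex. The conditional mean
  \<open>g\<close> falls under the induction hypothesis; its differences are averaged differences of
  \<open>f\<close> plus a correction, because flipping an old vertex changes the urn probabilities
  of the new one. That correction is again paid by flips of the new vertex.\<close>

lemma polya_poincare:
  "(\<Sum>x\<in>configs n. polya n x * (f x - (\<Sum>y\<in>configs n. polya n y * f y))\<^sup>2)
   \<le> (real n + 1) *
      (\<Sum>v\<in>vertices n. \<Sum>x\<in>configs n. \<Sum>s\<in>spins. polya n x * (f x - f (x(v := s)))\<^sup>2)"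
proof (induction n arbitrary: f)
  case 0
  have "configs 0 = {\<lambda>_. undefined}" by (simp add: configs_def vertices_def)
  then show ?case using sum_polya[of 0] by (simp add: vertices_def)
next
  case (Suc n)
  define F where "F x s = f (x(Suc n := s))" for x s
  define p where "p = polya_next n"
  define w where "w = polya n"
  define g where "g x = (\<Sum>s\<in>spins. p x s * F x s)" for x
  define m where "m = (\<Sum>x\<in>configs n. w x * g x)"
  \<comment> \<open>\<open>D v\<close> and \<open>E\<close> are the flip energies of the enlarged
    system at an old vertex \<open>v\<close> and at the new vertex, written with the last spin split
    off.\<close>
  define D where "D v = (\<Sum>x\<in>configs n. \<Sum>s\<in>spins. \<Sum>r\<in>spins. w x * p x s * (F x s - F (x(v := r)) s)\<^sup>2)" for v
  define E where "E = (\<Sum>x\<in>configs n. \<Sum>s\<in>spins. \<Sum>r\<in>spins. w x * p x s * (F x s - F x r)\<^sup>2)"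
  have p0: "p x s \<ge> 0" and w0: "w x \<ge> 0" for x s
    using polya_next_pos polya_pos by (auto simp: p_def w_def less_imp_le)
  have p1: "(\<Sum>s\<in>spins. p x s) = 1" if "x \<in> configs n" for x
    using that by (simp add: p_def sum_polya_next)
  have ple: "p x s \<le> 1" if "x \<in> configs n" "s \<in> spins" for x s
    using p1[OF that(1)] member_le_sum[OF that(2), of "p x"] p0 by simp
  have D0: "D v \<ge> 0" for v
    unfolding D_def by (intro sum_nonneg mult_nonneg_nonneg w0 p0) auto
  have mean: "(\<Sum>y\<in>configs (Suc n). polya (Suc n) y * f y) = m"
    by (simp add: sum_configs_Suc polya_Suc m_def g_def F_def sum_distrib_left w_def p_def mult.assoc)
  have "(\<Sum>x\<in>configs (Suc n). polya (Suc n) x * (f x - m)\<^sup>2)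
     = (\<Sum>x\<in>configs n. w x * (\<Sum>s\<in>spins. p x s * (F x s - m)\<^sup>2))"
    by (simp add: sum_configs_Suc polya_Suc F_def sum_distrib_left w_def p_def mult.assoc)
  \<comment> \<open>Variance given the first \<open>n\<close> spins, plus variance of the
    conditional mean.\<close>
  also have "\<dots> = (\<Sum>x\<in>configs n. w x * (\<Sum>s\<in>spins. p x s * (F x s - g x)\<^sup>2))
      + (\<Sum>x\<in>configs n. w x * (g x - m)\<^sup>2)"
    unfolding sum.distrib[symmetric] distrib_left[symmetric] g_def
    by (intro sum.cong refl arg_cong2[where f = "(*)"] weighted_sum_square_decomp p1)
  finally have decomp: "(\<Sum>x\<in>configs (Suc n). polya (Suc n) x * (f x - m)\<^sup>2) = \<dots>" .
  have "(\<Sum>x\<in>configs n. w x * (\<Sum>s\<in>spins. p x s * (F x s - g x)\<^sup>2)) \<le> E"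
  proof -
    have "(F x s - g x)\<^sup>2 \<le> (\<Sum>r\<in>spins. (F x s - F x r)\<^sup>2)"
      if "x \<in> configs n" "s \<in> spins" for x s
    proof -
      have "F x s - g x = (\<Sum>r\<in>spins. p x r * (F x s - F x r))"
        using p1[OF that(1)]
        by (simp add: g_def right_diff_distrib sum_subtractf flip: sum_distrib_right)
      then have "(F x s - g x)\<^sup>2 \<le> (\<Sum>r\<in>spins. p x r * (F x s - F x r)\<^sup>2)"
        using weighted_sum_square_le[of spins "p x" "\<lambda>r. F x s - F x r"] p0 p1[OF that(1)] by simp
      also have "\<dots> \<le> (\<Sum>r\<in>spins. 1 * (F x s - F x r)\<^sup>2)"
        by (intro sum_mono mult_right_mono ple that) auto
      finally show ?thesis by simp
    qed
    then have "(\<Sum>x\<in>configs n. w x * (\<Sum>s\<in>spins. p x s * (F x s - g x)\<^sup>2))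
       \<le> (\<Sum>x\<in>configs n. w x * (\<Sum>s\<in>spins. p x s * (\<Sum>r\<in>spins. (F x s - F x r)\<^sup>2)))"
      by (intro sum_mono mult_left_mono w0 p0) auto
    then show ?thesis by (simp add: E_def sum_distrib_left mult.assoc)
  qed
  moreover have "(\<Sum>x\<in>configs n. w x * (g x - m)\<^sup>2)
      \<le> (real n + 2) * (\<Sum>v\<in>vertices n. D v) + (real n + 1) * E"
  proof -
    define N where "N = real n"
    have N: "N \<ge> 0" by (simp add: N_def)
    \<comment> \<open>Young's inequality, with the weight for which the constant \<open>n + 1\<close> propagates to \<open>n + 2\<close>.\<close>
    have split_sq: "(a + b)\<^sup>2 \<le> (1 + 1 / (N + 2)) * a\<^sup>2 + (N + 3) * b\<^sup>2" for a b :: real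
    proof -
      define c where "c = a / (N + 2)"
      have a: "a = c * (N + 2)" using N by (simp add: c_def)
      have "0 \<le> (c - b)\<^sup>2 * (N + 2)" using N by simp
      also have "\<dots> = c * a - 2 * a * b + (N + 2) * b\<^sup>2"
        by (simp add: power2_eq_square algebra_simps a)
      also have "c * a = a\<^sup>2 / (N + 2)" by (simp add: c_def power2_eq_square)
      finally show ?thesis by (simp add: power2_eq_square algebra_simps)
    qed
    \<comment> \<open>Recolouring one ball from \<open>x v\<close> to \<open>r\<close> shifts
      exactly two urn probabilities, by \<open>1 / (N + 3)\<close> in opposite directions, unless
      the two spins agree; this produces the second term.\<close>
    have pt: "(g x - g (x(v := r)))\<^sup>2 \<le> (1 + 1 / (N + 2)) * (\<Sum>s\<in>spins. p x s * (F x s - F (x(v := r)) s)\<^sup>2)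
        + 1 / (N + 3) * (F (x(v := r)) (x v) - F (x(v := r)) r)\<^sup>2"
      if x: "x \<in> configs n" and v: "v \<in> vertices n" and r: "r \<in> spins" for x v r
    proof -
      define x' where "x' = x(v := r)"
      define A where "A = (\<Sum>s\<in>spins. p x s * (F x s - F x' s))"
      define B where "B = (F x' (x v) - F x' r) / (N + 3)"
      have "g x - g x' = A + (\<Sum>s\<in>spins. (p x s - p x' s) * F x' s)"
        by (simp add: g_def A_def right_diff_distrib left_diff_distrib sum_subtractf)
      moreover have "(\<Sum>s\<in>spins. (p x s - p x' s) * F x' s) = B"
      proof (cases "x v = r")
        case True
        then have "x' = x" by (auto simp: x'_def)
        then show ?thesis using True by (simp add: B_def)
      next
        case False
        have "real (spin_count n s x') = real (spin_count n s x) + of_bool (s = r) - of_bool (s = x v)" for s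
          using spin_count_upd[OF v, of x r s] False by (auto simp: x'_def split: if_splits)
        then have "(p x s - p x' s) * F x' s
           = ((if s = x v then F x' s else 0) - (if s = r then F x' s else 0)) / (N + 3)" for s
          using False by (simp add: p_def polya_next_def N_def flip: diff_divide_distrib)
        then show ?thesis
          using r configs_spin[OF x v]
          by (simp add: B_def sum_subtractf flip: sum_divide_distrib)
      qed
      ultimately have "(g x - g x')\<^sup>2 \<le> (1 + 1 / (N + 2)) * A\<^sup>2 + (N + 3) * B\<^sup>2"
        using split_sq[of A B] by simp
      also have "\<dots> \<le> (1 + 1 / (N + 2)) * (\<Sum>s\<in>spins. p x s * (F x s - F x' s)\<^sup>2) + (N + 3) * B\<^sup>2"
        unfolding A_def using N
        by (intro add_right_mono mult_left_mono weighted_sum_square_le p0 p1 x) auto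
      also have "(N + 3) * B\<^sup>2 = 1 / (N + 3) * (F x' (x v) - F x' r)\<^sup>2"
        using N by (simp add: B_def power_divide) (simp add: power2_eq_square)
      finally show ?thesis by (simp only: x'_def)
    qed
    \<comment> \<open>The sum of all corrections. Exchanging \<open>x\<close> with its flip produces
      the weight ratio \<open>(N + 3) * p x r\<close> over a class size, and the class size cancels
      when the vertices are summed by spin.\<close>
    define T where "T = (\<Sum>v\<in>vertices n. \<Sum>x\<in>configs n. \<Sum>r\<in>spins.
        w x * (F (x(v := r)) (x v) - F (x(v := r)) r)\<^sup>2)"
    have T: "T \<le> (N + 3) * E"
    proof -
      have "T = (\<Sum>v\<in>vertices n. \<Sum>x\<in>configs n. \<Sum>r\<in>spins. w (x(v := r)) * (F x r - F x (x v))\<^sup>2)"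
        unfolding T_def
      proof (rule sum.cong[OF refl])
        fix v assume "v \<in> vertices n"
        from sum_configs_flip[OF this, of "\<lambda>x r. w x * (F (x(v := r)) (x v) - F (x(v := r)) r)\<^sup>2"]
        show "(\<Sum>x\<in>configs n. \<Sum>r\<in>spins. w x * (F (x(v := r)) (x v) - F (x(v := r)) r)\<^sup>2)
          = (\<Sum>x\<in>configs n. \<Sum>r\<in>spins. w (x(v := r)) * (F x r - F x (x v))\<^sup>2)" by simp
      qed
      also have "\<dots> = (\<Sum>v\<in>vertices n. \<Sum>x\<in>configs n. \<Sum>r\<in>spins.
          (N + 3) * (w x * p x r * ((F x r - F x (x v))\<^sup>2 / spin_count n (x v) x)))"
      proof (intro sum.cong refl)
        fix v x r assume v: "v \<in> vertices n" and x: "x \<in> configs n" and r: "r \<in> spins"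
        show "w (x(v := r)) * (F x r - F x (x v))\<^sup>2
          = (N + 3) * (w x * p x r * ((F x r - F x (x v))\<^sup>2 / spin_count n (x v) x))"
        proof (cases "r = x v")
          case False
          have "(N + 3) * w x * p x r = w x * (real (spin_count n r x) + 1)"
            using N by (simp add: p_def polya_next_def N_def)
          also have "\<dots> = w (x(v := r)) * spin_count n (x v) x"
            using polya_upd[OF v, of x r] configs_spin[OF x v] r False by (simp add: w_def)
          finally have "w (x(v := r)) = (N + 3) * w x * p x r / spin_count n (x v) x"
            using spin_count_pos[OF v, of x] by simp
          then show ?thesis by simp
        qed simp
      qed
      also have "\<dots> = (\<Sum>x\<in>configs n. \<Sum>r\<in>spins. (N + 3) * (w x * p x r *
          (\<Sum>v\<in>vertices n. (F x r - F x (x v))\<^sup>2 / spin_count n (x v) x)))"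
        unfolding sum_distrib_left
        by (subst sum.swap, rule sum.cong, rule refl, subst sum.swap, rule refl)
      also have "\<dots> \<le> (\<Sum>x\<in>configs n. \<Sum>r\<in>spins. (N + 3) * (w x * p x r *
          (\<Sum>s\<in>spins. (F x r - F x s)\<^sup>2)))"
        using N by (intro sum_mono mult_left_mono mult_nonneg_nonneg w0 p0
            sum_vertices_by_spin[where G = "\<lambda>s. (F x r - F x s)\<^sup>2" for x r]) auto
      also have "\<dots> = (N + 3) * E"
        by (simp add: E_def sum_distrib_left)
      finally show ?thesis .
    qed
    have "(\<Sum>x\<in>configs n. w x * (g x - m)\<^sup>2)
      \<le> (N + 1) * (\<Sum>v\<in>vertices n. \<Sum>x\<in>configs n. \<Sum>r\<in>spins. w x * (g x - g (x(v := r)))\<^sup>2)"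
      using Suc.IH[of g] unfolding w_def m_def N_def .
    also have "\<dots> \<le> (N + 1) * (\<Sum>v\<in>vertices n. \<Sum>x\<in>configs n. \<Sum>r\<in>spins. w x *
        ((1 + 1 / (N + 2)) * (\<Sum>s\<in>spins. p x s * (F x s - F (x(v := r)) s)\<^sup>2)
        + 1 / (N + 3) * (F (x(v := r)) (x v) - F (x(v := r)) r)\<^sup>2))"
      using N by (intro mult_left_mono sum_mono pt w0) auto
    also have "\<dots> = (N + 1) * ((1 + 1 / (N + 2)) * (\<Sum>v\<in>vertices n. \<Sum>x\<in>configs n. \<Sum>r\<in>spins.
         \<Sum>s\<in>spins. w x * p x s * (F x s - F (x(v := r)) s)\<^sup>2) + 1 / (N + 3) * T)"
      by (simp only: T_def distrib_left sum.distrib sum_distrib_left mult_ac)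
    also have "(\<Sum>v\<in>vertices n. \<Sum>x\<in>configs n. \<Sum>r\<in>spins.
         \<Sum>s\<in>spins. w x * p x s * (F x s - F (x(v := r)) s)\<^sup>2) = (\<Sum>v\<in>vertices n. D v)"
      unfolding D_def by (intro sum.cong refl sum.swap)
    also have "(N + 1) * ((1 + 1 / (N + 2)) * (\<Sum>v\<in>vertices n. D v) + 1 / (N + 3) * T)
       \<le> (N + 2) * (\<Sum>v\<in>vertices n. D v) + (N + 1) * E"
    proof -
      \<comment> \<open>Holds since \<open>(N + 1) * (N + 3) = (N + 2)\<^sup>2 - 1\<close>.\<close>
      have "(N + 1) * (1 + 1 / (N + 2)) \<le> N + 2" using N by (simp add: field_simps)
      then have "(N + 1) * (1 + 1 / (N + 2)) * (\<Sum>v\<in>vertices n. D v) \<le> (N + 2) * (\<Sum>v\<in>vertices n. D v)"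
        using D0 by (intro mult_right_mono sum_nonneg)
      moreover have "1 / (N + 3) * T \<le> E"
        using T N by (simp add: field_simps)
      then have "(N + 1) * (1 / (N + 3) * T) \<le> (N + 1) * E"
        using N by (intro mult_left_mono) auto
      moreover have "(N + 1) * (a * S + b) = (N + 1) * a * S + (N + 1) * b" for a b S
        by (simp add: algebra_simps)
      ultimately show ?thesis by (metis add_mono)
    qed
    finally show ?thesis by (simp add: N_def)
  qed
  \<comment> \<open>The conditional variance costs one \<open>E\<close> and the conditional mean
    another \<open>n + 1\<close>, so the new vertex ends with the same coefficient
    \<open>n + 2\<close> as the old ones.\<close>
  ultimately have "(\<Sum>x\<in>configs (Suc n). polya (Suc n) x * (f x - m)\<^sup>2)
     \<le> (real n + 2) * ((\<Sum>v\<in>vertices n. D v) + E)"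
    unfolding decomp by (simp add: algebra_simps)
  also have "(\<Sum>v\<in>vertices n. D v) + E
     = (\<Sum>v\<in>vertices (Suc n). \<Sum>x\<in>configs (Suc n). \<Sum>s\<in>spins.
          polya (Suc n) x * (f x - f (x(v := s)))\<^sup>2)"
  proof -
    have "Suc n \<notin> vertices n" by (simp add: vertices_def)
    moreover have "D v = (\<Sum>x\<in>configs (Suc n). \<Sum>s\<in>spins.
          polya (Suc n) x * (f x - f (x(v := s)))\<^sup>2)" if "v \<in> vertices n" for v
    proof -
      have "v \<noteq> Suc n" using that by (auto simp: vertices_def)
      then show ?thesis
        by (simp add: sum_configs_Suc polya_Suc D_def F_def w_def p_def fun_upd_twist[of v])
    qed
    moreover have "E = (\<Sum>x\<in>configs (Suc n). \<Sum>s\<in>spins.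
          polya (Suc n) x * (f x - f (x(Suc n := s)))\<^sup>2)"
      by (simp add: sum_configs_Suc polya_Suc E_def F_def w_def p_def)
    ultimately show ?thesis by (simp add: vertices_Suc)
  qed
  finally have "(\<Sum>x\<in>configs (Suc n). polya (Suc n) x * (f x - m)\<^sup>2)
     \<le> (real n + 2) * (\<Sum>v\<in>vertices (Suc n). \<Sum>x\<in>configs (Suc n). \<Sum>s\<in>spins.
          polya (Suc n) x * (f x - f (x(v := s)))\<^sup>2)" .
  moreover have "real (Suc n) + 1 = real n + 2" by simp
  ultimately show ?case unfolding mean by (simp only:)
qed

section \<open>The level distributions\<close>

lemma potts_H_Suc:
  "potts_H (Suc n) (x(Suc n := s)) = potts_H n x + spin_count n s x"
proof -
  define L where "L n = {(i, j). i \<in> vertices n \<and> j \<in> vertices n \<and> i < j}" for n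
  have L: "L (Suc n) = L n \<union> (\<lambda>i. (i, Suc n)) ` vertices n"
    by (auto simp: L_def vertices_def)
  have fin: "finite (L n)"
    by (rule finite_subset[of _ "vertices n \<times> vertices n"]) (auto simp: L_def)
  have "potts_H (Suc n) (x(Suc n := s))
     = (\<Sum>(i, j)\<in>L n. of_bool ((x(Suc n := s)) i = (x(Suc n := s)) j))
     + (\<Sum>(i, j)\<in>(\<lambda>i. (i, Suc n)) ` vertices n. of_bool ((x(Suc n := s)) i = (x(Suc n := s)) j))"
    unfolding potts_H_def L_def[symmetric] L
    by (rule sum.union_disjoint) (use fin in \<open>auto simp: L_def vertices_def\<close>)
  also have "(\<Sum>(i, j)\<in>L n. of_bool ((x(Suc n := s)) i = (x(Suc n := s)) j)) = potts_H n x"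
    unfolding potts_H_def L_def[symmetric]
    by (intro sum.cong refl) (auto simp: L_def vertices_def)
  also have "(\<Sum>(i, j)\<in>(\<lambda>i. (i, Suc n)) ` vertices n. of_bool ((x(Suc n := s)) i = (x(Suc n := s)) j))
     = (\<Sum>i\<in>vertices n. of_bool (x i = s))"
    by (subst sum.reindex) (auto simp: inj_on_def vertices_def intro!: sum.cong)
  also have "\<dots> = real (spin_count n s x)"
    by (simp add: spin_count_def of_bool_def sum.If_cases Int_def conj_commute)
  finally show ?thesis .
qed

lemma configs_Suc_cases:
  assumes "y \<in> configs (Suc n)"
  obtains x s where "x \<in> configs n" "s \<in> spins" "y = x(Suc n := s)"
proof -
  have "y \<in> (\<lambda>(s, x). x(Suc n := s)) ` (spins \<times> configs n)"
    using assms by (simp add: configs_def vertices_Suc PiE_insert_eq)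
  then show ?thesis using that by auto
qed

text \<open>By induction, a new vertex of spin \<open>s\<close> closes one monochromatic edge with
  each earlier vertex of that spin. The point is that the energy, and with it every level weight,
  depends on the type alone.\<close>

lemma potts_H_spin_count:
  assumes "x \<in> configs n"
  shows "potts_H n x = (\<Sum>s\<in>spins. real (spin_count n s x) * (real (spin_count n s x) - 1) / 2)"
  using assms
proof (induction n arbitrary: x)
  case 0
  then show ?case by (simp add: potts_H_def vertices_def spin_count_def)
next
  case (Suc n)
  from Suc.prems obtain y s where y: "y \<in> configs n" "s \<in> spins" "x = y(Suc n := s)"
    by (rule configs_Suc_cases)
  show ?case
    unfolding y(3) potts_H_Suc Suc.IH[OF y(1)] spin_count_Suc
    using y(2) by (auto simp: sum_spins) (auto simp: spins_def field_simps)
qed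

lemma potts_H_bounds: "0 \<le> potts_H n x" "potts_H n x \<le> (real n)\<^sup>2"
proof -
  define L where "L = {(i, j). i \<in> vertices n \<and> j \<in> vertices n \<and> i < j}"
  have "L \<subseteq> vertices n \<times> vertices n" by (auto simp: L_def)
  then have "card L \<le> card (vertices n \<times> vertices n)" by (intro card_mono) auto
  then have card: "real (card L) \<le> (real n)\<^sup>2"
    by (simp add: card_cartesian_product power2_eq_square flip: of_nat_mult)
  show "0 \<le> potts_H n x" unfolding potts_H_def by (intro sum_nonneg) auto
  have "potts_H n x \<le> (\<Sum>p\<in>L. 1)"
    unfolding potts_H_def L_def[symmetric] by (intro sum_mono) auto
  also have "\<dots> = real (card L)" by simp
  finally show "potts_H n x \<le> (real n)\<^sup>2" using card by linarith
qed

text \<open>Deleting the last vertex gives the recursion of the multinomial coefficients; keeping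
  the factorials on the left avoids division.\<close>

lemma card_spin_class:
  assumes "a + b + c = n"
  shows "fact a * fact b * fact c *
    card {x \<in> configs n. spin_count n 1 x = a \<and> spin_count n 2 x = b \<and> spin_count n 3 x = c} = fact n"
  using assms
proof (induction n arbitrary: a b c)
  case 0
  have "configs 0 = {\<lambda>_. undefined}" by (simp add: configs_def vertices_def)
  then show ?case using 0 by (simp add: spin_count_def vertices_def)
next
  case (Suc n)
  define N where "N n a b c =
    card {x \<in> configs n. spin_count n 1 x = a \<and> spin_count n 2 x = b \<and> spin_count n 3 x = c}" for n a b c
  have N: "N n a b c = (\<Sum>x\<in>configs n.
      of_bool (spin_count n 1 x = a \<and> spin_count n 2 x = b \<and> spin_count n 3 x = c))" for n a b c
    by (simp add: N_def of_bool_def sum.If_cases Int_def)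
  \<comment> \<open>The last vertex accounts for one of the three counts; the guards exclude a zero
    count, where subtracting 1 would truncate.\<close>
  have rec: "N (Suc n) a b c = (if a > 0 then N n (a - 1) b c else 0)
      + ((if b > 0 then N n a (b - 1) c else 0) + (if c > 0 then N n a b (c - 1) else 0))"
    unfolding N sum_configs_Suc sum_spins sum.distrib spin_count_Suc
    by (intro arg_cong2[where f = "(+)"]; cases a; cases b; cases c; simp)
  have IH: "fact a * fact b * fact c * N n a b c = fact n" if "a + b + c = n" for a b c
    using Suc.IH[OF that] by (simp add: N_def)
  have "fact a * fact b * fact c * N (Suc n) a b c = a * fact n + b * fact n + c * fact n"
  proof -
    have "fact a * fact b * fact c * (if a > 0 then N n (a - 1) b c else 0) = a * fact n"
      using IH[of "a - 1" b c] Suc.prems by (cases a) (auto simp: algebra_simps)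
    moreover have "fact a * fact b * fact c * (if b > 0 then N n a (b - 1) c else 0) = b * fact n"
      using IH[of a "b - 1" c] Suc.prems by (cases b) (auto simp: algebra_simps)
    moreover have "fact a * fact b * fact c * (if c > 0 then N n a b (c - 1) else 0) = c * fact n"
      using IH[of a b "c - 1"] Suc.prems by (cases c) (auto simp: algebra_simps)
    ultimately show ?thesis unfolding rec distrib_left by simp
  qed
  also have "\<dots> = fact (Suc n)" using Suc.prems by (simp flip: distrib_right)
  finally show ?case by (simp add: N_def)
qed

definition same_type :: "nat \<Rightarrow> config \<Rightarrow> config set" where
  "same_type n x = {y \<in> configs n. \<forall>s\<in>spins. spin_count n s y = spin_count n s x}"

lemma card_same_type: "x \<in> configs n \<Longrightarrow> real (card (same_type n x)) = multinomial3 n x"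
proof -
  assume x: "x \<in> configs n"
  have "spin_count n 1 x + spin_count n 2 x + spin_count n 3 x = n"
    using sum_spin_count[OF x] by (simp add: sum_spins)
  from arg_cong[OF card_spin_class[OF this], of real]
  show ?thesis
    by (simp add: same_type_def multinomial3_def spins_def field_simps)
qed

lemma multinomial3_pos: "multinomial3 n x > 0"
  by (simp add: multinomial3_def)

lemma multinomial3_le: "x \<in> configs n \<Longrightarrow> multinomial3 n x \<le> 3 ^ n"
proof -
  assume x: "x \<in> configs n"
  have "card (same_type n x) \<le> card (configs n)"
    by (intro card_mono) (auto simp: same_type_def)
  then show ?thesis
    using card_same_type[OF x] card_configs[of n] by (metis of_nat_le_iff of_nat_numeral of_nat_power)
qed

section \<open>Level distributions as geometric progressions in the level\<close>

locale tempering =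
  fixes n M :: nat and \<beta> :: real
  assumes n_pos: "n \<ge> 1" and M_pos: "M \<ge> 1" and beta_nonneg: "\<beta> \<ge> 0"
begin

abbreviation rho :: "nat \<Rightarrow> config \<Rightarrow> real" where "rho \<equiv> level_dist n \<beta> M"

definition base :: "config \<Rightarrow> real" where
  "base x = 1 / multinomial3 n x"

text \<open>The \<open>M\<close>-th root of the ratio between the unnormalised weights of
  \<open>x\<close> at levels \<open>M\<close> and \<open>0\<close>, hence the factor gained per
  level.\<close>

definition growth :: "config \<Rightarrow> real" where
  "growth x = (multinomial3 n x * exp (\<beta> * potts_H n x)) powr (1 / real M)"

text \<open>The number of types, that is, of triples of natural numbers with sum
  \<open>n\<close>.\<close>

definition type_bound :: real where
  "type_bound = (real n + 1) * (real n + 2) / 2"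

lemma type_bound_pos: "type_bound > 0"
  by (simp add: type_bound_def add_nonneg_pos)

lemma base_pos: "base x > 0" and growth_pos: "growth x > 0"
  using multinomial3_pos[of n x] by (auto simp: base_def growth_def)

lemma level_weight:
  "exp (level_beta \<beta> M i * potts_H n x) * damping n M i x = base x * growth x ^ i"
proof -
  define u where "u = multinomial3 n x"
  have u: "u > 0" using multinomial3_pos by (simp add: u_def)
  have "growth x ^ i = (u * exp (\<beta> * potts_H n x)) powr (real i / real M)"
    using u by (simp add: growth_def u_def powr_power)
  also have "\<dots> = u powr (real i / real M) * exp (\<beta> * potts_H n x * (real i / real M))"
    using u by (subst powr_mult) (auto simp: powr_def)
  finally have g: "growth x ^ i = \<dots>" .
  have "(real i - real M) / real M = real i / real M - 1"
    using M_pos by (simp add: field_simps)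
  then have d: "damping n M i x = u powr (real i / real M) / u"
    using u by (simp add: damping_def powr_diff u_def)
  show ?thesis
    unfolding g d base_def u_def[symmetric] level_beta_def by (simp add: field_simps)
qed

lemma potts_Z_pos: "potts_Z n b > 0"
  unfolding potts_Z_def using configs_nonempty by (intro sum_pos) auto

lemma level_dist_eq: "rho i x = base x * growth x ^ i / (\<Sum>y\<in>configs n. base y * growth y ^ i)"
proof -
  define Z where "Z = potts_Z n (level_beta \<beta> M i)"
  have Z: "Z > 0" by (simp add: Z_def potts_Z_pos)
  have w: "gibbs n (level_beta \<beta> M i) x * damping n M i x = base x * growth x ^ i / Z" for x
    using level_weight[of i x] by (simp add: gibbs_def Z_def field_simps)
  show ?thesis
    unfolding level_dist_def level_Z_def w sum_divide_distrib[symmetric] using Z by simp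
qed

lemma level_sum_pos: "(\<Sum>y\<in>configs n. base y * growth y ^ i) > 0"
  using configs_nonempty base_pos growth_pos by (intro sum_pos) auto

lemma rho_pos: "rho i x > 0"
  using level_sum_pos[of i] base_pos growth_pos by (simp add: level_dist_eq)

lemma sum_rho: "(\<Sum>x\<in>configs n. rho i x) = 1"
  using level_sum_pos[of i] by (simp add: level_dist_eq flip: sum_divide_distrib)

text \<open>The quotient of the two formulas is \<open>fact (n + 2) / (2 * fact n)\<close>. This
  identifies level \<open>0\<close> with the urn measure.\<close>

lemma base_eq_polya: "base x = type_bound * polya n x"
proof -
  define a b where "a = real n + 1" and "b = real n + 2"
  have "a \<noteq> 0" "b \<noteq> 0" by (auto simp: a_def b_def)
  moreover have "fact (n + 2) = b * a * fact n" by (simp add: a_def b_def algebra_simps)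
  ultimately show ?thesis
    unfolding base_def type_bound_def polya_def multinomial3_def a_def[symmetric] b_def[symmetric]
    by (simp del: fact_Suc add: field_simps)
qed

lemma rho_0: "rho 0 x = polya n x"
  using type_bound_pos
  by (simp add: level_dist_eq base_eq_polya sum_polya flip: sum_distrib_left)

text \<open>All configurations of one type have equal mass at level \<open>i\<close>, and there are
  \<open>multinomial3 n x\<close> of them, so each has mass at most \<open>base x\<close>. At level
  \<open>0\<close> the types share the mass equally, which loses only the number of types.\<close>

lemma rho_le:
  assumes x: "x \<in> configs n"
  shows "rho i x \<le> type_bound * rho 0 x"
proof -
  have "rho i y = rho i x" if "y \<in> same_type n x" for y
  proof -
    have "multinomial3 n y = multinomial3 n x" "potts_H n y = potts_H n x"
      using that x by (auto simp: same_type_def multinomial3_def potts_H_spin_count spins_def)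
    then show ?thesis by (simp add: level_dist_eq base_def growth_def)
  qed
  then have "multinomial3 n x * rho i x = (\<Sum>y\<in>same_type n x. rho i y)"
    by (simp add: card_same_type[OF x])
  also have "\<dots> \<le> (\<Sum>y\<in>configs n. rho i y)"
    by (intro sum_mono2) (auto simp: same_type_def less_imp_le rho_pos)
  finally have "rho i x \<le> base x"
    using multinomial3_pos[of n x] by (simp add: sum_rho base_def field_simps)
  then show ?thesis by (simp add: base_eq_polya rho_0)
qed

lemma inverse_rho:
  "1 / rho i x = (\<Sum>y\<in>configs n. base y / base x * (growth y / growth x) ^ i)"
  by (simp add: level_dist_eq sum_divide_distrib power_divide)

text \<open>Up to normalisation, \<open>rho i x\<close> is a geometric progression in \<open>i\<close>, so \<open>1 / rho i x\<close> is a sum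
  of geometric progressions, hence convex in \<open>i\<close>.\<close>

lemma inverse_rho_le:
  assumes "j \<le> i"
  shows "1 / rho j x \<le> 1 / rho 0 x + 1 / rho i x"
  unfolding inverse_rho sum.distrib[symmetric] distrib_left[symmetric]
proof (intro sum_mono mult_left_mono)
  fix y
  define r where "r = growth y / growth x"
  have r: "r \<ge> 0" using growth_pos by (simp add: r_def less_imp_le)
  show "r ^ j \<le> r ^ 0 + r ^ i"
  proof (cases "r \<le> 1")
    case True
    then show ?thesis using r power_le_one[of r j] by (simp add: add_increasing2)
  next
    case False
    then have "r ^ j \<le> r ^ i" using assms by (intro power_increasing) auto
    then show ?thesis by simp
  qed
qed (use base_pos in \<open>auto simp: less_imp_le\<close>)

text \<open>Multiply \<open>inverse_rho_le\<close> by \<open>rho i x\<close> and bound the level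
  \<open>0\<close> term by \<open>rho_le\<close>. Thus a descent from level \<open>i\<close> never
  meets a level that is much lighter at \<open>x\<close>.\<close>

lemma rho_le_lower_level:
  assumes "x \<in> configs n" "j \<le> i"
  shows "rho i x \<le> (type_bound + 1) * rho j x"
proof -
  have "rho i x / rho j x \<le> rho i x / rho 0 x + 1"
    using mult_left_mono[OF inverse_rho_le[OF assms(2), of x], of "rho i x"] rho_pos[of i x]
    by (simp add: distrib_left)
  also have "rho i x / rho 0 x \<le> type_bound"
    using rho_le[OF assms(1), of i] rho_pos[of 0 x] by (simp add: field_simps)
  finally show ?thesis using rho_pos[of j x] by (simp add: field_simps)
qed

text \<open>Convexity leaves only the two end levels: level \<open>0\<close>, where the inverse mass
  is a multinomial coefficient times \<open>type_bound\<close>, and level \<open>M\<close>, where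
  the damping exponent vanishes and the plain Gibbs measure remains.\<close>

lemma inverse_rho_bound:
  assumes x: "x \<in> configs n" and i: "i \<le> M"
  shows "1 / rho i x \<le> 3 ^ n * (type_bound + exp (\<beta> * (real n)\<^sup>2))"
proof -
  have "1 / rho 0 x = type_bound * multinomial3 n x"
    using base_eq_polya[of x] type_bound_pos multinomial3_pos[of n x] polya_pos[of n x]
    by (simp add: rho_0 base_def field_simps)
  also have "\<dots> \<le> type_bound * 3 ^ n"
    using multinomial3_le[OF x] type_bound_pos by (intro mult_left_mono) auto
  finally have 0: "1 / rho 0 x \<le> type_bound * 3 ^ n" .
  have top: "base y * growth y ^ M = exp (\<beta> * potts_H n y)" for y
    using M_pos multinomial3_pos[of n y]
    by (simp add: level_weight[symmetric] level_beta_def damping_def)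
  have "1 / rho M x = (\<Sum>y\<in>configs n. exp (\<beta> * potts_H n y)) / exp (\<beta> * potts_H n x)"
    by (simp add: level_dist_eq top)
  also have "\<dots> \<le> (\<Sum>y\<in>configs n. exp (\<beta> * potts_H n y)) / 1"
    using beta_nonneg potts_H_bounds(1)[of n x]
    by (intro divide_left_mono sum_nonneg) auto
  also have "\<dots> \<le> (\<Sum>y\<in>configs n. exp (\<beta> * (real n)\<^sup>2))"
    using potts_H_bounds(2) beta_nonneg
    by (simp del: sum_constant) (intro sum_mono; simp add: mult_left_mono)
  also have "\<dots> = 3 ^ n * exp (\<beta> * (real n)\<^sup>2)" by (simp add: card_configs)
  finally have "1 / rho M x \<le> \<dots>" .
  then show ?thesis
    using 0 inverse_rho_le[OF i, of x] by (simp add: algebra_simps)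
qed

end

section \<open>The tempering chain\<close>

lemma expectation_bind_bernoulli:
  fixes h :: "'a \<Rightarrow> real"
  assumes "0 \<le> p" "p \<le> 1" "\<And>b. finite (set_pmf (f b))"
  shows "measure_pmf.expectation (bernoulli_pmf p \<bind> f) h =
    p * measure_pmf.expectation (f True) h + (1 - p) * measure_pmf.expectation (f False) h"
  by (subst pmf_expectation_bind[of UNIV]) (use assms in \<open>auto simp: UNIV_bool\<close>)

lemma expectation_finite_support:
  fixes h :: "'a \<Rightarrow> real"
  assumes "finite S" "set_pmf p \<subseteq> S"
  shows "(\<Sum>w\<in>S. pmf p w * h w) = measure_pmf.expectation p h"
  using assms by (subst integral_measure_pmf_real[of S]) (auto simp: mult.commute)

lemma finite_set_bind_pmf:
  "finite (set_pmf p) \<Longrightarrow> (\<And>x. finite (set_pmf (f x))) \<Longrightarrow> finite (set_pmf (bind_pmf p f))"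
  by (simp add: set_bind_pmf)

lemma finite_bernoulli: "finite (set_pmf (bernoulli_pmf p))"
  by (rule finite)

lemma finite_return: "finite (set_pmf (return_pmf x))"
  by simp

lemmas finite_support = finite_set_bind_pmf finite_bernoulli finite_return

context tempering
begin

section \<open>Acceptance rates and expectations after one step of the tempering chain\<close>

definition level_up :: "nat \<Rightarrow> nat" where
  "level_up i = (if i < M then i + 1 else i)"

definition level_down :: "nat \<Rightarrow> nat" where
  "level_down i = (if 0 < i then i - 1 else i)"

definition spin_rate :: "nat \<Rightarrow> config \<Rightarrow> config \<Rightarrow> real" where
  "spin_rate i x y = min 1 (rho i y / rho i x)"

definition level_rate :: "config \<Rightarrow> nat \<Rightarrow> nat \<Rightarrow> real" where
  "level_rate x i j = min 1 (rho j x / rho i x)"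

lemma spin_rate: "0 \<le> spin_rate i x y" "spin_rate i x y \<le> 1"
  and level_rate: "0 \<le> level_rate x i j" "level_rate x i j \<le> 1"
  using rho_pos by (auto simp: spin_rate_def level_rate_def less_imp_le)

lemma rho_spin_rate: "rho i x * spin_rate i x y = min (rho i x) (rho i y)"
  and rho_level_rate: "rho i x * level_rate x i j = min (rho i x) (rho j x)"
  using rho_pos[of i x] by (auto simp: spin_rate_def level_rate_def min_def field_simps)

lemma vertices_nonempty: "vertices n \<noteq> {}"
  using n_pos by (simp add: vertices_def)

lemma spins_nonempty: "spins \<noteq> {}"
  by (simp add: spins_def)

abbreviation chain :: "config \<times> nat \<Rightarrow> (config \<times> nat) pmf" where
  "chain \<equiv> tempering_chain n \<beta> M"

lemma finite_metropolis: "finite (set_pmf (metropolis n r x))"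
  unfolding metropolis_def
  by (intro finite_support) (simp_all add: vertices_nonempty spins_nonempty)

lemma finite_level_move: "finite (set_pmf (level_move n \<beta> M z))"
  unfolding level_move_def case_prod_unfold
  by (intro finite_support) (simp add: finite_support finite_metropolis)

lemma finite_temperature_move: "finite (set_pmf (temperature_move n \<beta> M z))"
  unfolding temperature_move_def case_prod_unfold Let_def by (intro finite_support)

lemma expectation_metropolis:
  fixes h :: "config \<Rightarrow> real"
  shows "measure_pmf.expectation (metropolis n (rho i) x) h =
    (\<Sum>v\<in>vertices n. \<Sum>s\<in>spins. spin_rate i x (x(v := s)) * h (x(v := s))
       + (1 - spin_rate i x (x(v := s))) * h x) / (3 * real n)"
proof -
  define e where "e v s = spin_rate i x (x(v := s)) * h (x(v := s)) + (1 - spin_rate i x (x(v := s))) * h x" for v s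
  define K where "K v s = bernoulli_pmf (spin_rate i x (x(v := s))) \<bind>
    (\<lambda>accept. return_pmf (if accept then x(v := s) else x))" for v s
  have fin_K: "finite (set_pmf (K v s))" for v s
    unfolding K_def by (intro finite_support)
  have K: "measure_pmf.expectation (K v s) h = e v s" for v s
    unfolding K_def e_def by (subst expectation_bind_bernoulli) (simp_all add: spin_rate)
  have scale: "a /\<^sub>R c = a / c" for a c :: real
    by (simp add: divide_inverse)
  have fin_spin: "finite (set_pmf (pmf_of_set spins \<bind> K v))" for v
    by (intro finite_support fin_K) (simp add: spins_nonempty)
  have spin: "measure_pmf.expectation (pmf_of_set spins \<bind> K v) h = (\<Sum>s\<in>spins. e v s / real (card spins))" for v
    unfolding pmf_expectation_bind_pmf_of_set[OF spins_nonempty finite_spins fin_K] K scale ..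
  have "measure_pmf.expectation (pmf_of_set (vertices n) \<bind> (\<lambda>v. pmf_of_set spins \<bind> K v)) h
      = (\<Sum>v\<in>vertices n. (\<Sum>s\<in>spins. e v s / real (card spins)) / real (card (vertices n)))"
    unfolding pmf_expectation_bind_pmf_of_set[OF vertices_nonempty finite_vertices fin_spin] spin scale ..
  also have "\<dots> = (\<Sum>v\<in>vertices n. \<Sum>s\<in>spins. e v s) / (3 * real n)"
    by (simp only: sum_divide_distrib divide_divide_eq_left card_spins card_vertices of_nat_numeral)
  finally show ?thesis
    unfolding metropolis_def spin_rate_def[symmetric] K_def e_def .
qed

text \<open>The four summands are the active and the idle level move and the upward and the downward
  temperature move, each of probability 1/4. Indicator test functions give the transition
  probabilities, squared differences give the Dirichlet form.\<close>

lemma expectation_chain: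
  fixes h :: "config \<times> nat \<Rightarrow> real"
  shows "measure_pmf.expectation (chain (x, i)) h =
    ((\<Sum>v\<in>vertices n. \<Sum>s\<in>spins. spin_rate i x (x(v := s)) * h (x(v := s), i)
       + (1 - spin_rate i x (x(v := s))) * h (x, i)) / (3 * real n) + h (x, i)
     + (level_rate x i (level_up i) * h (x, level_up i) + (1 - level_rate x i (level_up i)) * h (x, i))
     + (level_rate x i (level_down i) * h (x, level_down i) + (1 - level_rate x i (level_down i)) * h (x, i))) / 4"
proof -
  have level: "measure_pmf.expectation (level_move n \<beta> M (x, i)) h =
     ((\<Sum>v\<in>vertices n. \<Sum>s\<in>spins. spin_rate i x (x(v := s)) * h (x(v := s), i)
       + (1 - spin_rate i x (x(v := s))) * h (x, i)) / (3 * real n) + h (x, i)) / 2"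
  proof -
    have "measure_pmf.expectation (metropolis n (rho i) x \<bind> (\<lambda>x'. return_pmf (x', i))) h
       = measure_pmf.expectation (metropolis n (rho i) x) (\<lambda>x'. h (x', i))"
      by (simp flip: map_pmf_def)
    then show ?thesis
      unfolding level_move_def prod.case
      by (subst expectation_bind_bernoulli)
         (simp_all add: finite_support finite_metropolis expectation_metropolis split: bool.split)
  qed
  have temp: "measure_pmf.expectation (temperature_move n \<beta> M (x, i)) h =
     (level_rate x i (level_up i) * h (x, level_up i) + (1 - level_rate x i (level_up i)) * h (x, i)
     + (level_rate x i (level_down i) * h (x, level_down i) + (1 - level_rate x i (level_down i)) * h (x, i))) / 2"
    unfolding temperature_move_def prod.case Let_def level_rate_def[symmetric]
      level_up_def[symmetric] level_down_def[symmetric]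
    by (subst expectation_bind_bernoulli)
       (simp_all add: finite_support expectation_bind_bernoulli level_rate add_divide_distrib)
  show ?thesis
    unfolding tempering_chain_def
    by (subst expectation_bind_bernoulli)
       (simp_all add: finite_level_move finite_temperature_move level temp add_divide_distrib)
qed

abbreviation states :: "(config \<times> nat) set" where
  "states \<equiv> tempering_states n M"

abbreviation stat :: "config \<times> nat \<Rightarrow> real" where
  "stat \<equiv> tempering_stationary n \<beta> M"

lemma finite_states: "finite states"
  by (simp add: tempering_states_def)

lemma sum_states: "(\<Sum>z\<in>states. F z) = (\<Sum>i\<le>M. \<Sum>x\<in>configs n. F (x, i))"
  unfolding tempering_states_def atMost_atLeast0
  by (subst sum.swap) (simp add: sum.cartesian_product)

lemma metropolis_closed:
  assumes "x \<in> configs n"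
  shows "set_pmf (metropolis n r x) \<subseteq> configs n"
  using assms unfolding metropolis_def
  by (auto simp: set_bind_pmf vertices_nonempty spins_nonempty configs_upd)

lemma chain_closed:
  assumes "z \<in> states"
  shows "set_pmf (chain z) \<subseteq> states"
proof -
  obtain x i where z: "z = (x, i)" by force
  then have x: "x \<in> configs n" and i: "i \<le> M"
    using assms by (auto simp: tempering_states_def)
  have "set_pmf (level_move n \<beta> M (x, i)) \<subseteq> insert (x, i) (set_pmf (metropolis n (rho i) x) \<times> {i})"
    unfolding level_move_def by (auto simp: set_bind_pmf split: if_splits)
  moreover have "set_pmf (temperature_move n \<beta> M (x, i)) \<subseteq> {x} \<times> {i, level_up i, level_down i}"
    unfolding temperature_move_def Let_def prod.case level_up_def[symmetric] level_down_def[symmetric]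
    by (auto simp: set_bind_pmf)
  moreover have "set_pmf (chain z)
      \<subseteq> set_pmf (level_move n \<beta> M (x, i)) \<union> set_pmf (temperature_move n \<beta> M (x, i))"
    unfolding tempering_chain_def z by (auto simp: set_bind_pmf split: if_splits)
  moreover have "level_up i \<le> M" "level_down i \<le> M"
    using i by (auto simp: level_up_def level_down_def)
  ultimately show ?thesis
    using metropolis_closed[OF x] x i by (fastforce simp: tempering_states_def)
qed

section \<open>Transition probabilities, holding and detailed balance\<close>

lemma pmf_eq_expectation: "pmf p w = measure_pmf.expectation p (\<lambda>u. of_bool (u = w))"
  for w :: 'a
proof -
  have "pmf p w = measure_pmf.expectation p (indicator {w})"
    by (simp add: measure_pmf_single)
  also have "indicator {w} = (\<lambda>u. of_bool (u = w) :: real)" by (auto simp: indicator_def)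
  finally show ?thesis .
qed

text \<open>The idle level move alone has probability 1/4.\<close>

lemma chain_hold: "pmf (chain z) z \<ge> 1/4"
proof -
  obtain x i where z: "z = (x, i)" by force
  have spin: "0 \<le> (\<Sum>v\<in>vertices n. \<Sum>s\<in>spins. spin_rate i x (x(v := s)) * of_bool ((x(v := s), i) = z)
       + (1 - spin_rate i x (x(v := s))) * of_bool ((x, i) = z)) / (3 * real n)"
    using spin_rate
    by (intro divide_nonneg_nonneg sum_nonneg add_nonneg_nonneg mult_nonneg_nonneg) auto
  have "0 \<le> level_rate x i j * of_bool ((x, j) = z) + (1 - level_rate x i j) * of_bool ((x, i) = z)" for j
    using level_rate by (intro add_nonneg_nonneg mult_nonneg_nonneg) auto
  note up = this[of "level_up i"] and down = this[of "level_down i"]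
  have "pmf (chain z) z = measure_pmf.expectation (chain (x, i)) (\<lambda>u. of_bool (u = z))"
    unfolding pmf_eq_expectation z ..
  moreover have "1/4 \<le> (a + e + b + c) / 4" if "0 \<le> a" "0 \<le> b" "0 \<le> c" "e = 1" for a b c e :: real
    using that by simp
  from this[OF spin up down] have "(1/4 :: real) \<le> measure_pmf.expectation (chain (x, i)) (\<lambda>u. of_bool (u = z))"
    unfolding expectation_chain by (simp add: z)
  ultimately show ?thesis by simp
qed

text \<open>For each vertex at most the spin \<open>y v\<close> can lead to \<open>y\<close>. The
  right-hand side is symmetric in \<open>x\<close> and \<open>y\<close>, as detailed balance
  requires.\<close>

lemma single_spin_moves:
  assumes "x \<in> configs n" "y \<in> configs n"
  shows "(\<Sum>v\<in>vertices n. \<Sum>s\<in>spins. of_bool (x(v := s) = y))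
    = (\<Sum>v\<in>vertices n. of_bool (\<forall>u. u \<noteq> v \<longrightarrow> x u = y u) :: real)"
proof (intro sum.cong refl)
  fix v assume v: "v \<in> vertices n"
  have "of_bool (x(v := s) = y)
      = (if s = y v then of_bool (\<forall>u. u \<noteq> v \<longrightarrow> x u = y u) else 0 :: real)" for s
    by (auto simp: fun_eq_iff)
  then show "(\<Sum>s\<in>spins. of_bool (x(v := s) = y)) = (of_bool (\<forall>u. u \<noteq> v \<longrightarrow> x u = y u) :: real)"
    using configs_spin[OF assms(2) v] by simp
qed

text \<open>All proposals that reach \<open>y\<close> share one acceptance rate;
  \<open>12 * n\<close> combines the branch probability 1/4 with the \<open>3 * n\<close> equally
  likely proposals.\<close>

lemma pmf_chain_spin:
  assumes "x \<in> configs n" "y \<in> configs n" "x \<noteq> y"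
  shows "pmf (chain (x, i)) (y, i) = spin_rate i x y
    * (\<Sum>v\<in>vertices n. of_bool (\<forall>u. u \<noteq> v \<longrightarrow> x u = y u)) / (12 * real n)"
proof -
  have "pmf (chain (x, i)) (y, i)
     = (\<Sum>v\<in>vertices n. \<Sum>s\<in>spins. spin_rate i x (x(v := s)) * of_bool (x(v := s) = y)) / (3 * real n) / 4"
    using assms(3) by (simp add: pmf_eq_expectation expectation_chain)
  also have "(\<Sum>v\<in>vertices n. \<Sum>s\<in>spins. spin_rate i x (x(v := s)) * of_bool (x(v := s) = y))
     = spin_rate i x y * (\<Sum>v\<in>vertices n. \<Sum>s\<in>spins. of_bool (x(v := s) = y))"
    unfolding sum_distrib_left by (intro sum.cong refl) auto
  finally show ?thesis
    unfolding single_spin_moves[OF assms(1,2)] by (simp del: sum_of_bool_eq)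
qed

lemma pmf_chain_level:
  assumes "i \<noteq> j"
  shows "pmf (chain (x, i)) (y, j) =
    of_bool (x = y) * level_rate x i j * (of_bool (level_up i = j) + of_bool (level_down i = j)) / 4"
proof -
  have *: "level_rate x i k * of_bool ((x, k) = (y, j)) = of_bool (x = y) * level_rate x i j * of_bool (k = j)" for k
    by simp
  have "pmf (chain (x, i)) (y, j)
    = (level_rate x i (level_up i) * of_bool ((x, level_up i) = (y, j))
     + level_rate x i (level_down i) * of_bool ((x, level_down i) = (y, j))) / 4"
    using assms by (simp add: pmf_eq_expectation expectation_chain)
  then show ?thesis unfolding * distrib_left .
qed

lemma chain_balance:
  assumes "z \<in> states" "w \<in> states"
  shows "stat z * pmf (chain z) w = stat w * pmf (chain w) z"
proof -
  obtain x i y j where zw: "z = (x, i)" "w = (y, j)" by force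
  have in_states: "x \<in> configs n" "y \<in> configs n" "i \<le> M" "j \<le> M"
    using assms by (auto simp: zw tempering_states_def)
  have "z = w \<or> i = j \<and> x \<noteq> y \<or> i \<noteq> j"
    unfolding zw prod.inject by blast
  then show ?thesis
  proof (elim disjE)
    assume "z = w"
    then show ?thesis by (simp only:)
  next
    assume "i = j \<and> x \<noteq> y"
    then have 2: "i = j" "x \<noteq> y" by blast+
    have "rho i x * spin_rate i x y = rho i y * spin_rate i y x"
      by (simp add: rho_spin_rate min.commute)
    moreover have "(\<Sum>v\<in>vertices n. of_bool (\<forall>u. u \<noteq> v \<longrightarrow> x u = y u))
        = (\<Sum>v\<in>vertices n. of_bool (\<forall>u. u \<noteq> v \<longrightarrow> y u = x u) :: real)"
      by (simp add: eq_commute)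
    ultimately show ?thesis
      using 2 in_states by (simp add: zw pmf_chain_spin tempering_stationary_def)
  next
    assume 3: "i \<noteq> j"
    have "rho i x * level_rate x i j = rho j x * level_rate x j i"
      by (simp add: rho_level_rate min.commute)
    \<comment> \<open>An upward proposal from \<open>k\<close> to \<open>l\<close> is a downward one
      from \<open>l\<close> to \<open>k\<close> reversed; \<open>k \<noteq> l\<close> rules out the
      proposals that stay put at an end level.\<close>
    have up_down: "level_up k = l \<longleftrightarrow> level_down l = k" if "k \<noteq> l" "k \<le> M" "l \<le> M" for k l
      using that unfolding level_up_def level_down_def by presburger
    note flip = up_down[OF 3 in_states(3,4)] up_down[OF 3[symmetric] in_states(4,3)]
    have regroup: "a / c * (b * r * k / 4) = (a * r) * (b * k / (4 * c))" for a b c k r :: real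
      by (simp add: mult_ac)
    show ?thesis
    proof (cases "x = y")
      case True
      with \<open>rho i x * level_rate x i j = rho j x * level_rate x j i\<close> show ?thesis
        unfolding zw pmf_chain_level[OF 3] pmf_chain_level[OF 3[symmetric]] tempering_stationary_def
          prod.case regroup flip
        by (simp only: add.commute)
    next
      case False
      then show ?thesis using 3 by (simp add: zw pmf_chain_level)
    qed
  qed
qed

sublocale reversible_chain states chain stat
proof
  show "sum stat states = 1"
    by (simp add: sum_states tempering_stationary_def sum_rho flip: sum_divide_distrib)
  show "stat z > 0" for z
    using rho_pos by (auto simp: tempering_stationary_def split: prod.split)
  show "finite states" by (rule finite_states)
  show "set_pmf (chain z) \<subseteq> states" if "z \<in> states" for z
    using that by (rule chain_closed)
  show "stat z * pmf (chain z) w = stat w * pmf (chain w) z" if "z \<in> states" "w \<in> states" for z w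
    using that by (rule chain_balance)
qed

section \<open>Lower bound on the Dirichlet form and Poincare inequality of the tempering
  chain\<close>

definition level_energy :: "(config \<times> nat \<Rightarrow> real) \<Rightarrow> real" where
  "level_energy f = (\<Sum>x\<in>configs n. \<Sum>k<M. min (rho (Suc k) x) (rho k x) * (f (x, Suc k) - f (x, k))\<^sup>2)"

text \<open>The flip energy of \<open>polya_poincare\<close> for \<open>f\<close> at level
  \<open>0\<close>, weighted by \<open>polya n x\<close> instead of the Metropolis minimum of two
  masses.\<close>

definition spin_energy :: "(config \<times> nat \<Rightarrow> real) \<Rightarrow> real" where
  "spin_energy f = (\<Sum>v\<in>vertices n. \<Sum>x\<in>configs n. \<Sum>s\<in>spins. polya n x * (f (x, 0) - f (x(v := s), 0))\<^sup>2)"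

text \<open>For a genuine flip the ratio of the two masses is \<open>spin_count n (x v) x\<close>
  over \<open>spin_count n s x + 1\<close>. At the price of a factor \<open>n\<close>, the
  Metropolis minimum can thus be replaced by \<open>polya n x\<close>.\<close>

lemma polya_le_upd:
  assumes "x \<in> configs n" "v \<in> vertices n" "s \<in> spins"
  shows "polya n x \<le> real n * polya n (x(v := s))"
proof (cases "s = x v")
  case True
  then have "x(v := s) = x" by simp
  moreover have "1 * polya n x \<le> real n * polya n x"
    using n_pos polya_pos[of n x] by (intro mult_right_mono) auto
  ultimately show ?thesis by (simp only: mult_1)
next
  case False
  have "polya n x * 1 \<le> polya n x * (real (spin_count n s x) + 1)"
    using polya_pos[of n x] by (intro mult_left_mono) auto
  also have "\<dots> = polya n (x(v := s)) * spin_count n (x v) x"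
    using polya_upd[of v n x s] configs_spin assms False by simp
  also have "\<dots> \<le> polya n (x(v := s)) * real n"
    using polya_pos[of n "x(v := s)"] spin_count_le by (intro mult_left_mono) auto
  finally show ?thesis by (simp add: mult.commute)
qed

text \<open>Only the spin moves at level \<open>0\<close> and the downward temperature moves are
  kept. The factor \<open>4 * (real M + 1)\<close> undoes the branch probability and the uniform
  weight of the levels; in \<open>3 * (real n)\<^sup>2\<close> there are \<open>3 * n\<close>
  proposals and one \<open>n\<close> from \<open>polya_le_upd\<close>.\<close>

lemma dirichlet_ge:
  "level_energy f + spin_energy f / (3 * (real n)\<^sup>2) \<le> 4 * (real M + 1) * dirichlet f"
proof -
  define A where "A i x = (\<Sum>v\<in>vertices n. \<Sum>s\<in>spins.
      rho i x * spin_rate i x (x(v := s)) * (f (x, i) - f (x(v := s), i))\<^sup>2) / (3 * real n)" for i x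
  define B where "B i x = rho i x * level_rate x i (level_down i) * (f (x, i) - f (x, level_down i))\<^sup>2" for i x
  have A0: "A i x \<ge> 0" for i x
    unfolding A_def
    by (intro divide_nonneg_nonneg sum_nonneg mult_nonneg_nonneg less_imp_le[OF rho_pos] spin_rate) auto
  have B0: "B i x \<ge> 0" for i x
    unfolding B_def
    by (intro mult_nonneg_nonneg less_imp_le[OF rho_pos] level_rate) auto
  have "spin_energy f / (3 * (real n)\<^sup>2) \<le> (\<Sum>x\<in>configs n. A 0 x)"
  proof -
    have "polya n x / real n \<le> rho 0 x * spin_rate 0 x (x(v := s))"
      if "x \<in> configs n" "v \<in> vertices n" "s \<in> spins" for x v s
    proof -
      have "1 * polya n x \<le> real n * polya n x"
        using n_pos polya_pos[of n x] by (intro mult_right_mono) auto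
      then show ?thesis
        using polya_le_upd[OF that] n_pos
        unfolding rho_spin_rate by (simp add: rho_0 pos_divide_le_eq mult.commute)
    qed
    then have "(\<Sum>x\<in>configs n. \<Sum>v\<in>vertices n. \<Sum>s\<in>spins.
          polya n x / real n * (f (x, 0) - f (x(v := s), 0))\<^sup>2) / (3 * real n)
        \<le> (\<Sum>x\<in>configs n. A 0 x)"
      unfolding A_def sum_divide_distrib[symmetric]
      by (intro divide_right_mono sum_mono mult_right_mono) auto
    also have "(\<Sum>x\<in>configs n. \<Sum>v\<in>vertices n. \<Sum>s\<in>spins.
          polya n x / real n * (f (x, 0) - f (x(v := s), 0))\<^sup>2) = spin_energy f / real n"
      unfolding spin_energy_def by (subst sum.swap) (simp add: sum_divide_distrib)
    finally show ?thesis by (simp add: power2_eq_square mult_ac)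
  qed
  moreover have "level_energy f = (\<Sum>x\<in>configs n. \<Sum>i\<in>{..M} - {0}. B i x)"
  proof -
    have "{..M} - {0} = Suc ` {..<M}" by (auto simp: image_Suc_lessThan)
    then have "(\<Sum>i\<in>{..M} - {0}. B i x) = (\<Sum>k<M. B (Suc k) x)" for x
      by (simp add: sum.reindex)
    then show ?thesis
      by (simp add: level_energy_def B_def level_down_def rho_level_rate)
  qed
  moreover have "(\<Sum>x\<in>configs n. A 0 x) \<le> (\<Sum>i\<le>M. \<Sum>x\<in>configs n. A i x)"
    by (rule member_le_sum) (auto intro!: sum_nonneg A0)
  moreover have "(\<Sum>x\<in>configs n. \<Sum>i\<in>{..M} - {0}. B i x) \<le> (\<Sum>i\<le>M. \<Sum>x\<in>configs n. B i x)"
    by (subst sum.swap) (intro sum_mono2, auto intro!: sum_nonneg B0)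
  moreover have "(\<Sum>i\<le>M. \<Sum>x\<in>configs n. A i x + B i x) \<le> 4 * (real M + 1) * dirichlet f"
  proof -
    define Q where "Q i x = rho i x *
      measure_pmf.expectation (chain (x, i)) (\<lambda>w. (f (x, i) - f w)\<^sup>2)" for i x
    have "dirichlet f = (\<Sum>z\<in>states. stat z * measure_pmf.expectation (chain z) (\<lambda>w. (f z - f w)\<^sup>2))"
      unfolding dirichlet_def
      by (intro sum.cong refl) (simp add: expectation_finite_support finite_states chain_closed)
    also have "\<dots> = (\<Sum>i\<le>M. \<Sum>x\<in>configs n. Q i x) / (real M + 1)"
      by (simp add: sum_states tempering_stationary_def sum_divide_distrib Q_def)
    finally have Q: "dirichlet f = (\<Sum>i\<le>M. \<Sum>x\<in>configs n. Q i x) / (real M + 1)" .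
    have "real M + 1 \<noteq> 0" by linarith
    from iffD1[OF nonzero_eq_divide_eq[OF this] Q] have "dirichlet f * (real M + 1) = (\<Sum>i\<le>M. \<Sum>x\<in>configs n. Q i x)" .
    then have "4 * (real M + 1) * dirichlet f = 4 * (\<Sum>i\<le>M. \<Sum>x\<in>configs n. Q i x)"
      by (simp only: mult.assoc mult.commute)
    then have "4 * (real M + 1) * dirichlet f = (\<Sum>i\<le>M. \<Sum>x\<in>configs n. 4 * Q i x)"
      by (simp only: sum_distrib_left)
    moreover have "A i x + B i x \<le> 4 * Q i x" for i x
    proof -
      define S where "S = (\<Sum>v\<in>vertices n. \<Sum>s\<in>spins. spin_rate i x (x(v := s)) * (f (x, i) - f (x(v := s), i))\<^sup>2)"
      have "A i x = rho i x * S / (3 * real n)"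
        by (simp add: A_def S_def sum_distrib_left mult.assoc)
      moreover have "4 * measure_pmf.expectation (chain (x, i)) (\<lambda>w. (f (x, i) - f w)\<^sup>2)
         = S / (3 * real n) + level_rate x i (level_up i) * (f (x, i) - f (x, level_up i))\<^sup>2
         + level_rate x i (level_down i) * (f (x, i) - f (x, level_down i))\<^sup>2"
        unfolding expectation_chain by (simp add: S_def)
      from arg_cong[OF this, of "\<lambda>r. rho i x * r"]
      have "4 * Q i x = rho i x * S / (3 * real n)
         + rho i x * level_rate x i (level_up i) * (f (x, i) - f (x, level_up i))\<^sup>2
         + rho i x * level_rate x i (level_down i) * (f (x, i) - f (x, level_down i))\<^sup>2"
        unfolding Q_def by (simp add: distrib_left mult_ac)
      ultimately have "4 * Q i x = A i x + B i x
         + rho i x * level_rate x i (level_up i) * (f (x, i) - f (x, level_up i))\<^sup>2"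
        by (simp add: B_def)
      moreover have "rho i x * level_rate x i (level_up i) * (f (x, i) - f (x, level_up i))\<^sup>2 \<ge> 0"
        using rho_pos level_rate by (simp add: less_imp_le)
      ultimately show ?thesis by linarith
    qed
    ultimately show ?thesis by (simp add: sum_mono)
  qed
  ultimately show ?thesis by (simp add: sum.distrib)
qed

text \<open>Bounds the inverse spectral gap in the normalisation of \<open>dirichlet\<close>. The
  two summands pay for the descent to level \<open>0\<close> and for the relaxation there.\<close>

definition relaxation_bound :: real where
  "relaxation_bound = 8 * (real M + 1) *
     (real M * (type_bound + 1) + 3 * type_bound * (real n + 1) * (real n)\<^sup>2)"

text \<open>All levels are compared with the mean \<open>c\<close> of \<open>f\<close> at level
  \<open>0\<close>. The difference \<open>f (x, i) - c\<close> splits into the descent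
  \<open>f (x, i) - f (x, 0)\<close>, which telescopes over the levels, and
  \<open>f (x, 0) - c\<close>, which is handled by \<open>rho_le\<close> and the urn
  inequality.\<close>

lemma tempering_poincare: "variance f \<le> relaxation_bound * dirichlet f"
proof -
  define c where "c = (\<Sum>x\<in>configs n. polya n x * f (x, 0))"
  have tb: "type_bound \<ge> 0" using type_bound_pos by simp
  have "variance f \<le> (\<Sum>i\<le>M. \<Sum>x\<in>configs n. rho i x * (f (x, i) - c)\<^sup>2) / (real M + 1)"
    using variance_le[of f c] unfolding mean_def sum_states
    by (simp add: tempering_stationary_def sum_divide_distrib)
  also have "\<dots> \<le> (\<Sum>i\<le>M. 2 * real M * (type_bound + 1) * level_energy f
      + 2 * type_bound * (real n + 1) * spin_energy f) / (real M + 1)"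
  proof (intro divide_right_mono sum_mono)
    fix i assume "i \<in> {..M}"
    then have i: "i \<le> M" by simp
    have "(\<Sum>x\<in>configs n. rho i x * (f (x, i) - f (x, 0))\<^sup>2)
      \<le> real M * (type_bound + 1) * level_energy f"
      unfolding level_energy_def sum_distrib_left
    proof (intro sum_mono)
      fix x assume x: "x \<in> configs n"
      have "f (x, i) - f (x, 0) = (\<Sum>k<i. f (x, Suc k) - f (x, k))"
        by (rule sum_lessThan_telescope[symmetric])
      then have "(f (x, i) - f (x, 0))\<^sup>2 \<le> real i * (\<Sum>k<i. (f (x, Suc k) - f (x, k))\<^sup>2)"
        using sum_square_le_card[of "\<lambda>k. f (x, Suc k) - f (x, k)" "{..<i}"] by simp
      also have "\<dots> \<le> real M * (\<Sum>k<i. (f (x, Suc k) - f (x, k))\<^sup>2)"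
        using i by (intro mult_right_mono sum_nonneg) auto
      finally have "rho i x * (f (x, i) - f (x, 0))\<^sup>2
          \<le> rho i x * (real M * (\<Sum>k<i. (f (x, Suc k) - f (x, k))\<^sup>2))"
        using rho_pos[of i x] by (intro mult_left_mono) auto
      also have "\<dots> = (\<Sum>k<i. real M * (rho i x * (f (x, Suc k) - f (x, k))\<^sup>2))"
        by (simp add: sum_distrib_left mult_ac)
      \<comment> \<open>Both ends of the edge from \<open>k\<close> to \<open>Suc k\<close> lie at
        or below level \<open>i\<close>, so \<open>rho_le_lower_level\<close> bounds
        \<open>rho i x\<close> by either mass and hence by their minimum.\<close>
      also have "\<dots> \<le> (\<Sum>k<i. real M * ((type_bound + 1) * min (rho (Suc k) x) (rho k x)
          * (f (x, Suc k) - f (x, k))\<^sup>2))"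
        using rho_le_lower_level[OF x, of _ i]
        by (intro sum_mono mult_left_mono mult_right_mono) (auto simp: min_def)
      also have "\<dots> \<le> (\<Sum>k<M. real M * ((type_bound + 1) * min (rho (Suc k) x) (rho k x)
          * (f (x, Suc k) - f (x, k))\<^sup>2))"
        using i tb rho_pos by (intro sum_mono2) (auto simp: min_def less_imp_le)
      finally show "rho i x * (f (x, i) - f (x, 0))\<^sup>2 \<le> (\<Sum>k<M. real M * (type_bound + 1)
          * (min (rho (Suc k) x) (rho k x) * (f (x, Suc k) - f (x, k))\<^sup>2))"
        by (simp add: mult.assoc)
    qed
    moreover have "(\<Sum>x\<in>configs n. rho i x * (f (x, 0) - c)\<^sup>2)
      \<le> type_bound * ((real n + 1) * spin_energy f)"
    proof -
      have "(\<Sum>x\<in>configs n. rho i x * (f (x, 0) - c)\<^sup>2)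
        \<le> (\<Sum>x\<in>configs n. type_bound * polya n x * (f (x, 0) - c)\<^sup>2)"
        using rho_le by (intro sum_mono mult_right_mono) (auto simp: rho_0)
      also have "\<dots> = type_bound * (\<Sum>x\<in>configs n. polya n x * (f (x, 0) - c)\<^sup>2)"
        by (simp add: sum_distrib_left mult.assoc)
      also have "\<dots> \<le> type_bound * ((real n + 1) * spin_energy f)"
        unfolding c_def spin_energy_def
        by (intro mult_left_mono polya_poincare[of n "\<lambda>x. f (x, 0)"] tb)
      finally show ?thesis .
    qed
    moreover have "(\<Sum>x\<in>configs n. rho i x * (f (x, i) - c)\<^sup>2)
       \<le> 2 * (\<Sum>x\<in>configs n. rho i x * (f (x, i) - f (x, 0))\<^sup>2)
       + 2 * (\<Sum>x\<in>configs n. rho i x * (f (x, 0) - c)\<^sup>2)"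
      unfolding sum_distrib_left sum.distrib[symmetric]
    proof (intro sum_mono)
      fix x
      have "(a + b)\<^sup>2 \<le> 2 * a\<^sup>2 + 2 * b\<^sup>2" for a b :: real
        using zero_le_power2[of "a - b"] by (simp add: power2_eq_square algebra_simps)
      from this[of "f (x, i) - f (x, 0)" "f (x, 0) - c"]
      have "(f (x, i) - c)\<^sup>2 \<le> 2 * (f (x, i) - f (x, 0))\<^sup>2 + 2 * (f (x, 0) - c)\<^sup>2" by simp
      from mult_left_mono[OF this, of "rho i x"] rho_pos[of i x]
      show "rho i x * (f (x, i) - c)\<^sup>2
        \<le> 2 * (rho i x * (f (x, i) - f (x, 0))\<^sup>2) + 2 * (rho i x * (f (x, 0) - c)\<^sup>2)"
        by (simp add: distrib_left mult_ac)
    qed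
    ultimately show "(\<Sum>x\<in>configs n. rho i x * (f (x, i) - c)\<^sup>2)
      \<le> 2 * real M * (type_bound + 1) * level_energy f + 2 * type_bound * (real n + 1) * spin_energy f"
      by (simp add: mult.assoc)
  qed simp
  also have "\<dots> = 2 * real M * (type_bound + 1) * level_energy f
      + 2 * type_bound * (real n + 1) * spin_energy f"
  proof -
    have "(\<Sum>i\<le>M. X) / (real M + 1) = X" for X :: real
      by (simp add: field_simps)
    then show ?thesis .
  qed
  \<comment> \<open>For nonnegative energies the coefficients may be added, once
    \<open>spin_energy f\<close> is rescaled to the form in which \<open>dirichlet_ge\<close>
    provides it.\<close>
  also have "\<dots> \<le> (2 * real M * (type_bound + 1) + 6 * type_bound * (real n + 1) * (real n)\<^sup>2)
      * (level_energy f + spin_energy f / (3 * (real n)\<^sup>2))"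
  proof -
    define a b c where "a = 2 * real M * (type_bound + 1)" and "b = 2 * type_bound * (real n + 1)"
      and "c = 3 * (real n)\<^sup>2"
    define S where "S = spin_energy f / c"
    have c: "c > 0" using n_pos by (simp add: c_def)
    have "spin_energy f \<ge> 0" "level_energy f \<ge> 0"
      unfolding spin_energy_def level_energy_def using polya_pos rho_pos
      by (auto intro!: sum_nonneg mult_nonneg_nonneg simp: less_imp_le min_def)
    then have "S \<ge> 0" "level_energy f \<ge> 0" "spin_energy f = c * S"
      using c by (auto simp: S_def)
    moreover have "a \<ge> 0" "b \<ge> 0" using tb by (auto simp: a_def b_def)
    ultimately have "a * level_energy f + b * spin_energy f \<le> (a + b * c) * (level_energy f + S)"
      using c by (simp add: algebra_simps)
    moreover have "b * c = 6 * type_bound * (real n + 1) * (real n)\<^sup>2"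
      by (simp add: b_def c_def)
    ultimately show ?thesis by (simp only: a_def b_def c_def S_def)
  qed
  also have "\<dots> \<le> (2 * real M * (type_bound + 1) + 6 * type_bound * (real n + 1) * (real n)\<^sup>2)
      * (4 * (real M + 1) * dirichlet f)"
    using tb by (intro mult_left_mono dirichlet_ge) auto
  also have "\<dots> = relaxation_bound * dirichlet f"
    by (simp add: relaxation_bound_def algebra_simps)
  finally show ?thesis .
qed

end

section \<open>The mixing time\<close>

context tempering
begin

text \<open>Bounds the logarithm of the largest inverse stationary probability: \<open>M\<close>
  stands for the \<open>M + 1\<close> levels, \<open>2 * n\<close> for \<open>3 ^ n\<close>, and the
  rest for the second factor in \<open>inverse_rho_bound\<close>.\<close>

definition log_bound :: real where
  "log_bound = real M + 2 * real n + type_bound + \<beta> * (real n)\<^sup>2"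

lemma inverse_stat_le:
  assumes "z \<in> states"
  shows "1 / stat z \<le> exp log_bound"
proof -
  obtain x i where z: "z = (x, i)" by force
  then have x: "x \<in> configs n" and i: "i \<le> M"
    using assms by (auto simp: tempering_states_def)
  define b where "b = \<beta> * (real n)\<^sup>2"
  have b: "b \<ge> 0" using beta_nonneg by (simp add: b_def)
  have "(3::real) \<le> exp 2" using exp_ge_add_one_self[of 2] by simp
  then have 3: "(3::real) ^ n \<le> exp (2 * real n)"
    using power_mono[of 3 "exp 2 :: real" n] by (simp add: exp_of_nat_mult[symmetric] mult.commute)
  have "type_bound + exp b \<le> (1 + type_bound) * exp b"
    using b type_bound_pos mult_left_mono[of 1 "exp b" type_bound] by (simp add: algebra_simps)
  also have "\<dots> \<le> exp type_bound * exp b"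
    by (intro mult_right_mono exp_ge_add_one_self) auto
  finally have tb: "type_bound + exp b \<le> exp (type_bound + b)" by (simp add: exp_add)
  have "1 / stat z = (real M + 1) * (1 / rho i x)"
    by (simp add: z tempering_stationary_def)
  also have "\<dots> \<le> exp (real M) * (exp (2 * real n) * exp (type_bound + b))"
  proof (rule mult_mono)
    show "real M + 1 \<le> exp (real M)"
      using exp_ge_add_one_self[of "real M"] by (simp add: add.commute)
    have "1 / rho i x \<le> 3 ^ n * (type_bound + exp b)"
      unfolding b_def by (rule inverse_rho_bound[OF x i])
    also have "\<dots> \<le> exp (2 * real n) * exp (type_bound + b)"
      using 3 tb type_bound_pos by (intro mult_mono) (auto simp: add_nonneg_nonneg)
    finally show "1 / rho i x \<le> exp (2 * real n) * exp (type_bound + b)" .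
  qed (use rho_pos[of i x] in auto)
  also have "\<dots> = exp log_bound"
    by (simp add: log_bound_def b_def add_ac flip: exp_add)
  finally show ?thesis .
qed

lemma relaxation_bound_ge: "relaxation_bound \<ge> 1"
proof -
  have "1 * 1 \<le> (8 * (real M + 1)) *
     (real M * (type_bound + 1) + 3 * type_bound * (real n + 1) * (real n)\<^sup>2)"
  proof (rule mult_mono)
    have "1 * 1 \<le> real M * (type_bound + 1)"
      using M_pos type_bound_pos by (intro mult_mono) auto
    then show "1 \<le> real M * (type_bound + 1) + 3 * type_bound * (real n + 1) * (real n)\<^sup>2"
      using type_bound_pos by (simp add: add_increasing2)
  qed auto
  then show ?thesis by (simp add: relaxation_bound_def)
qed

text \<open>With holding probability 1/4 the variance of the density is at most
  \<open>exp (log_bound - t / (4 * relaxation_bound))\<close>, and the condition on \<open>t\<close>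
  makes this at most \<open>\<epsilon>\<^sup>2\<close>.\<close>

lemma tv_to_le_eps:
  assumes z: "z \<in> states" and eps: "0 < \<epsilon>"
    and t: "real t \<ge> 4 * relaxation_bound * (log_bound + 2 * ln (1 / \<epsilon>))"
  shows "tv_to states chain stat t z \<le> \<epsilon>"
proof -
  define L where "L = relaxation_bound"
  have L: "L \<ge> 1" using relaxation_bound_ge by (simp add: L_def)
  have "variance (density z t) \<le> (1 - 1/4 / L) ^ t / stat z"
    using L z chain_hold tempering_poincare
    by (intro variance_density) (auto simp: L_def)
  also have "\<dots> = (1 - 1/4 / L) ^ t * (1 / stat z)" by simp
  also have "\<dots> \<le> exp (- (real t / (4 * L))) * exp log_bound"
  proof (rule mult_mono)
    have "(1 - 1/4 / L) ^ t \<le> exp (- (1/4 / L)) ^ t"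
      using L exp_ge_add_one_self[of "- (1/4 / L)"] by (intro power_mono) (auto simp: field_simps)
    then show "(1 - 1/4 / L) ^ t \<le> exp (- (real t / (4 * L)))"
      by (simp add: exp_of_nat_mult[symmetric])
  qed (use inverse_stat_le[OF z] stationary_pos[OF z] in auto)
  also have "\<dots> = exp (log_bound - real t / (4 * L))"
    by (simp flip: exp_add)
  also have "\<dots> \<le> exp (2 * ln \<epsilon>)"
  proof -
    have "log_bound + 2 * ln (1 / \<epsilon>) \<le> real t / (4 * L)"
      using t L by (simp add: L_def field_simps)
    then show ?thesis using eps by (simp add: ln_div)
  qed
  also have "\<dots> = \<epsilon>\<^sup>2"
    using eps by (simp add: exp_double)
  finally have "sqrt (variance (density z t)) \<le> \<epsilon>"
    using eps by (intro real_le_lsqrt) auto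
  then show ?thesis using tv_to_le[OF z, of t] eps by linarith
qed

lemma tempering_mixing_time_le:
  assumes eps: "0 < \<epsilon>" and T: "real T \<ge> 4 * relaxation_bound * (log_bound + 2 * ln (1 / \<epsilon>))"
  shows "tempering_mixing_time n \<beta> M \<epsilon> \<le> enat T"
proof -
  have "states \<noteq> {}" using configs_nonempty by (auto simp: tempering_states_def)
  have "(MAX z\<in>states. tv_to states chain stat t z) \<le> \<epsilon>" if "t \<ge> T" for t
  proof (rule Max.boundedI)
    have t: "real t \<ge> 4 * relaxation_bound * (log_bound + 2 * ln (1 / \<epsilon>))"
      using T that by linarith
    show "a \<le> \<epsilon>" if "a \<in> tv_to states chain stat t ` states" for a
      using that tv_to_le_eps[OF _ eps t] by blast
  qed (use \<open>states \<noteq> {}\<close> finite_states in auto)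
  then show ?thesis
    unfolding tempering_mixing_time_def mixing_time_def by (intro INF_lower) auto
qed

end

text \<open>With \<open>Y\<close> above both parameters every bound becomes a monomial:
  \<open>Y ^ 6\<close> from the relaxation bound and \<open>Y ^ 2\<close> from the logarithm, where
  the energy contributes only \<open>\<mu> * n\<close>. Here \<open>1408 = 4 * 352\<close>, and the
  added \<open>1\<close> absorbs rounding up to an integer time.\<close>

lemma tempering_mixing_time_polynomial:
  fixes \<mu> \<epsilon> Y :: real
  assumes "\<mu> > 0" "n \<ge> 1" "M \<ge> 1" "0 < \<epsilon>" "\<epsilon> < 1" "real n \<le> Y" "real M \<le> Y"
  shows "tempering_mixing_time n (\<mu> / real n) M \<epsilon> < \<infinity>"
    and "real (the_enat (tempering_mixing_time n (\<mu> / real n) M \<epsilon>))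
      \<le> (1408 * (6 + \<mu> + 2 * ln (1 / \<epsilon>)) + 1) * Y ^ 8"
proof -
  interpret tempering n M "\<mu> / real n"
    using assms by unfold_locales auto
  have Y: "Y \<ge> 1" using assms by linarith
  have Yp: "Y ^ i \<le> Y ^ j" if "i \<le> j" for i j
    using that Y by (rule power_increasing)
  define l where "l = 2 * ln (1 / \<epsilon>)"
  have l: "l \<ge> 0" using assms by (simp add: l_def)
  have tb0: "type_bound \<ge> 0" using type_bound_pos by simp
  \<comment> \<open>As \<open>Y \<ge> 1\<close>, constants are absorbed:
    \<open>n + 1 \<le> 2 * Y\<close> and \<open>n + 2 \<le> 3 * Y\<close>.\<close>
  have "(real n + 1) * (real n + 2) \<le> (2 * Y) * (3 * Y)"
    using assms(6) Y by (intro mult_mono) auto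
  then have tb: "type_bound \<le> 3 * Y ^ 2"
    by (simp add: type_bound_def power2_eq_square)
  have relax: "relaxation_bound \<le> 352 * Y ^ 6"
  proof -
    have "type_bound + 1 \<le> 4 * Y ^ 2"
      using tb one_le_power[OF Y, of 2] by linarith
    then have "real M * (type_bound + 1) \<le> Y * (4 * Y ^ 2)"
      using assms(7) Y tb0 by (intro mult_mono) auto
    also have "\<dots> = 4 * Y ^ 3" by (simp add: eval_nat_numeral)
    also have "\<dots> \<le> 4 * Y ^ 5" using Yp[of 3 5] by simp
    finally have 1: "real M * (type_bound + 1) \<le> 4 * Y ^ 5" .
    have "3 * type_bound * (real n + 1) * (real n)\<^sup>2 \<le> (3 * (3 * Y ^ 2)) * (2 * Y) * Y ^ 2"
      using assms(6) Y tb tb0 by (intro mult_mono power_mono) auto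
    also have "\<dots> = 18 * Y ^ 5" by (simp add: eval_nat_numeral)
    finally have "real M * (type_bound + 1) + 3 * type_bound * (real n + 1) * (real n)\<^sup>2 \<le> 22 * Y ^ 5"
      using 1 by simp
    then have "relaxation_bound \<le> (8 * (2 * Y)) * (22 * Y ^ 5)"
      unfolding relaxation_bound_def using assms(7) Y tb0 by (intro mult_mono) auto
    also have "\<dots> = 352 * Y ^ 6" by (simp add: eval_nat_numeral)
    finally show ?thesis .
  qed
  have log: "log_bound + l \<le> (6 + \<mu> + l) * Y ^ 2"
  proof -
    have "\<mu> / real n * (real n)\<^sup>2 = \<mu> * real n"
      using assms(2) by (simp add: power2_eq_square)
    moreover have "\<mu> * real n \<le> \<mu> * Y ^ 2" "real M \<le> Y ^ 2" "real n \<le> Y ^ 2"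
      using assms(1,6,7) Yp[of 1 2] by (auto intro!: mult_left_mono)
    moreover have "l * 1 \<le> l * Y ^ 2"
      using l Y by (intro mult_left_mono) auto
    ultimately show ?thesis using tb by (simp add: log_bound_def distrib_right)
  qed
  define B where "B = 4 * relaxation_bound * (log_bound + l)"
  have lb0: "log_bound \<ge> 0"
    unfolding log_bound_def using tb0 assms(1) by (intro add_nonneg_nonneg) auto
  have B0: "B \<ge> 0"
    unfolding B_def using relaxation_bound_ge lb0 l by simp
  have "B \<le> 4 * (352 * Y ^ 6) * ((6 + \<mu> + l) * Y ^ 2)"
    unfolding B_def using relax log relaxation_bound_ge lb0 l Y by (intro mult_mono) auto
  also have "\<dots> = 1408 * (6 + \<mu> + l) * Y ^ 8" by (simp add: eval_nat_numeral)
  finally have B: "B \<le> \<dots>" .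
  define T where "T = nat \<lceil>B\<rceil>"
  have T: "real T \<ge> B" "real T \<le> B + 1"
    using B0 by (auto simp: T_def)
  have "tempering_mixing_time n (\<mu> / real n) M \<epsilon> \<le> enat T"
    using tempering_mixing_time_le[OF assms(4), of T] T(1) by (simp add: B_def l_def)
  then obtain m where m: "tempering_mixing_time n (\<mu> / real n) M \<epsilon> = enat m" "m \<le> T"
    by (cases "tempering_mixing_time n (\<mu> / real n) M \<epsilon>") auto
  then show "tempering_mixing_time n (\<mu> / real n) M \<epsilon> < \<infinity>" by simp
  have "real m \<le> B + 1" using m(2) T(2) by linarith
  also have "\<dots> \<le> (1408 * (6 + \<mu> + l) + 1) * Y ^ 8"
    using B Yp[of 0 8] by (simp add: distrib_right)
  finally show "real (the_enat (tempering_mixing_time n (\<mu> / real n) M \<epsilon>))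
      \<le> (1408 * (6 + \<mu> + 2 * ln (1 / \<epsilon>)) + 1) * Y ^ 8"
    by (simp add: m(1) l_def)
qed

theorem theorem7p7:
  fixes \<mu> :: real and M :: "nat \<Rightarrow> nat"
  assumes "\<mu> > 0"
    and "\<And>n. n \<ge> 1 \<Longrightarrow> M n \<ge> 1"
    and "\<exists>k::real. (\<lambda>n. real (M n)) \<in> O(\<lambda>n. real n powr k)"
  shows "\<exists>c\<^sub>8::real. c\<^sub>8 > 0 \<and> (\<forall>\<epsilon>::real. 0 < \<epsilon> \<and> \<epsilon> < 1 \<longrightarrow>
           (\<forall>n\<ge>1. tempering_mixing_time n (\<mu> / real n) (M n) \<epsilon> < \<infinity>) \<and>
           (\<lambda>n. real (the_enat (tempering_mixing_time n (\<mu> / real n) (M n) \<epsilon>)))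
             \<in> O(\<lambda>n. real n powr c\<^sub>8))"
proof -
  obtain k where "(\<lambda>n. real (M n)) \<in> O(\<lambda>n. real n powr k)" using assms(3) by blast
  then obtain C where C: "C > 0" "eventually (\<lambda>n. real (M n) \<le> C * real n powr k) at_top"
    by (auto elim!: landau_o.bigE)
  \<comment> \<open>The exponent \<open>k\<close> may be negative or below 1; this \<open>K\<close>
    dominates both \<open>1\<close> and \<open>k\<close>.\<close>
  define K where "K = \<bar>k\<bar> + 1"
  show ?thesis
  proof (intro exI[of _ "8 * K"] conjI allI impI)
    show "8 * K > 0" by (simp add: K_def)
  next
    fix \<epsilon> :: real and n :: nat
    assume "0 < \<epsilon> \<and> \<epsilon> < 1" "1 \<le> n"
    \<comment> \<open>Finiteness is claimed for every \<open>n\<close>, not only eventually, so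
      \<open>Y\<close> is taken as the larger of the two parameters.\<close>
    then show "tempering_mixing_time n (\<mu> / real n) (M n) \<epsilon> < \<infinity>"
      using assms(1,2)
      by (intro tempering_mixing_time_polynomial(1)[where Y = "max (real n) (real (M n))"]) auto
  next
    fix \<epsilon> :: real
    assume eps: "0 < \<epsilon> \<and> \<epsilon> < 1"
    define c where "c = 1408 * (6 + \<mu> + 2 * ln (1 / \<epsilon>)) + 1"
    show "(\<lambda>n. real (the_enat (tempering_mixing_time n (\<mu> / real n) (M n) \<epsilon>)))
      \<in> O(\<lambda>n. real n powr (8 * K))"
    proof (rule bigoI[where c = "c * (C + 1) ^ 8"])
      show "eventually (\<lambda>n. norm (real (the_enat (tempering_mixing_time n (\<mu> / real n) (M n) \<epsilon>)))
        \<le> c * (C + 1) ^ 8 * norm (real n powr (8 * K))) at_top"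
        using C(2) eventually_ge_at_top[of 1]
      proof eventually_elim
        case (elim n)
        \<comment> \<open>Since \<open>C + 1\<close> exceeds both \<open>1\<close> and
          \<open>C\<close>, this \<open>Y\<close> bounds \<open>n\<close> and \<open>M n\<close> at
          once.\<close>
        define Y where "Y = (C + 1) * real n powr K"
        have n: "real n \<ge> 1" using elim(2) by simp
        have pow: "real n powr 1 \<le> real n powr K" "real n powr k \<le> real n powr K"
          by (rule powr_mono; use n in \<open>simp add: K_def\<close>)+
        then have "1 * real n \<le> Y"
          unfolding Y_def using C(1) n by (intro mult_mono) auto
        moreover have "C * real n powr k \<le> Y"
          unfolding Y_def using C(1) pow by (intro mult_mono) auto
        ultimately have "real (the_enat (tempering_mixing_time n (\<mu> / real n) (M n) \<epsilon>)) \<le> c * Y ^ 8"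
          unfolding c_def using eps elim assms(1,2)
          by (intro tempering_mixing_time_polynomial(2)) auto
        also have "Y ^ 8 = (C + 1) ^ 8 * real n powr (8 * K)"
          using n by (simp add: Y_def power_mult_distrib powr_power mult.commute)
        finally show ?case by (simp add: mult.assoc)
      qed
    qed
  qed
qed

end
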